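(* Let $(\mathcal{M},g)$ be a paracompact, connected, pseudo-Riemannian manifold of dimension $n$ and signature $(p,q)$, and let $U\subseteq\mathcal{M}$ be an open set with a local orthonormal coframe $\{e^1,\dots,e^n\}$ of $T^{*}\mathcal{M}$. If $p-q\equiv 0,1,4,5\pmod 8$, then $$\Gamma(U,\textstyle\bigwedge(T^{*}\mathcal{M}))=\Gamma_+\oplus\Gamma_-.$$
   Context: The constant function $1$ on $U$, viewed as a $0$-form, is denoted $1_\Gamma$. Let $\{e_1,\dots,e_n\}$ be the frame of $T\mathcal{M}$ over $U$ dual to $\{e^i\}$, so $e^i(e_j)=\delta^i_j$. Let $g^{*}$ be the metric induced by $g$ on $T^{*}\mathcal{M}$ and $g^{ij}=g^{*}(e^i,e^j)$; orthonormal means $g^{ij}=0$ for $i\ne j$, $g^{ii}=1$ for $1\le i\le p$ and $g^{ii}=-1$ for $p+1\le i\le n$. $e_i\rfloor$ denotes contraction (interior product) on forms: the linear map of degree $-1$ vanishing on $0$-forms with $e_i\rfloor e^j=\delta_i^j 1_\Gamma$ and $e_i\rfloor(\alpha\wedge\beta)=(e_i\rfloor\alpha)\wedge\beta+(-1)^{\deg\alpha}\alpha\wedge(e_i\rfloor\beta)$. The contracted wedge product of order $l\ge 0$ on $\Gamma(U,\bigwedge(T^{*}\mathcal{M}))$ is defined iteratively by $f_1\wedge_0 f_2=f_1\wedge f_2$ and $f_1\wedge_l f_2=\sum_{i,j=1}^n g^{ij}(e_i\rfloor f_1)\wedge_{l-1}(e_j\rfloor f_2)$ for $l\ge1$. The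 Graf product $\diamond$ is the bilinear product on $\Gamma(U,\bigwedge(T^{*}\mathcal{M}))$ defined for an $r$-form $f_1$ and an $s$-form $f_2$ with $r\le s$ by $$f_1\diamond f_2=\sum_{l=0}^r\frac{(-1)^{l(r-l)+[l/2]}}{l!}f_1\wedge_l f_2,\qquad f_2\diamond f_1=(-1)^{rs}\sum_{l=0}^r\frac{(-1)^{l(r-l+1)+[l/2]}}{l!}f_1\wedge_l f_2,$$ where $[x]$ is the integer part of $x$. Let $\mathbf{v}=e^1\wedge\cdots\wedge e^n$ be the volume element. The Hodge operator is the linear map $\star f=f\diamond\mathbf{v}$ on $\Gamma(U,\bigwedge(T^{*}\mathcal{M}))$. Put $p_\pm=\frac12(1_\Gamma\pm\mathbf{v})$, $P_\pm(f)=f\diamond p_\pm=\frac12(f\pm\star f)$, and $\Gamma_\pm=P_\pm\big(\Gamma(U,\bigwedge(T^{*}\mathcal{M}))\big)$. *)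

theory Defs
  imports "HOL-Analysis.Analysis"
begin

section \<open>Smooth functions on open subsets of Euclidean space\<close>

primrec C_k_on :: "nat \<Rightarrow> 'v::real_normed_vector set \<Rightarrow> ('v \<Rightarrow> 'w::real_normed_vector) \<Rightarrow> bool" where
  "C_k_on 0 S f \<longleftrightarrow> continuous_on S f"
| "C_k_on (Suc k) S f \<longleftrightarrow>
     (\<forall>x\<in>S. f differentiable (at x)) \<and>
     (\<forall>v. C_k_on k S (\<lambda>x. frechet_derivative f (at x) v))"

definition smooth_on :: "'v::real_normed_vector set \<Rightarrow> ('v \<Rightarrow> 'w::real_normed_vector) \<Rightarrow> bool" where
  "smooth_on S f \<longleftrightarrow> (\<forall>k. C_k_on k S f)"


section \<open>Smooth manifolds\<close>

text \<open>A chart is a pair of its domain and its coordinate map; the values of the coordinate map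
  outside the domain are irrelevant. The dimension is the cardinality of the index type \<open>'n\<close>.\<close>

type_synonym ('a, 'n) chart = "'a set \<times> ('a \<Rightarrow> real ^ 'n)"

definition chart_inv :: "('a, 'n) chart \<Rightarrow> real ^ 'n \<Rightarrow> 'a" where
  "chart_inv c = inv_into (fst c) (snd c)"

definition is_chart :: "'a topology \<Rightarrow> ('a, 'n::finite) chart \<Rightarrow> bool" where
  "is_chart M c \<longleftrightarrow>
     openin M (fst c) \<and> open (snd c ` fst c) \<and>
     homeomorphic_map (subtopology M (fst c)) (top_of_set (snd c ` fst c)) (snd c)"

definition smooth_atlas :: "'a topology \<Rightarrow> ('a, 'n::finite) chart set \<Rightarrow> bool" where
  "smooth_atlas M A \<longleftrightarrow>
     (\<forall>c\<in>A. is_chart M c) \<and>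
     (\<Union>c\<in>A. fst c) = topspace M \<and>
     (\<forall>c\<in>A. \<forall>d\<in>A. smooth_on (snd c ` (fst c \<inter> fst d)) (snd d \<circ> chart_inv c))"

text \<open>The atlas is not required to be maximal: the tangent spaces and smooth sections below
  only depend on the smooth structure that it generates.\<close>

definition smooth_manifold :: "'a topology \<Rightarrow> ('a, 'n::finite) chart set \<Rightarrow> bool" where
  "smooth_manifold M A \<longleftrightarrow> Hausdorff_space M \<and> smooth_atlas M A"

definition paracompact_space :: "'a topology \<Rightarrow> bool" where
  "paracompact_space M \<longleftrightarrow>
     (\<forall>\<C>. (\<forall>C\<in>\<C>. openin M C) \<and> \<Union>\<C> = topspace M \<longrightarrow>
        (\<exists>\<D>. (\<forall>D\<in>\<D>. openin M D) \<and> \<Union>\<D> = topspace M \<and>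
             (\<forall>D\<in>\<D>. \<exists>C\<in>\<C>. D \<subseteq> C) \<and> locally_finite_in M \<D>))"

definition smooth_fun :: "('a, 'n::finite) chart set \<Rightarrow> 'a set \<Rightarrow> ('a \<Rightarrow> real) \<Rightarrow> bool" where
  "smooth_fun A U h \<longleftrightarrow> (\<forall>c\<in>A. smooth_on (snd c ` (fst c \<inter> U)) (h \<circ> chart_inv c))"


section \<open>Tangent vectors\<close>

text \<open>A tangent vector at \<open>x\<close> assigns to every chart around \<open>x\<close> a coordinate vector, and these
  coordinate vectors are related by the Jacobians of the coordinate changes. Charts not
  containing \<open>x\<close> are sent to 0, so that tangent vectors are determined by their coordinates.\<close>

type_synonym ('a, 'n) tvec = "('a, 'n) chart \<Rightarrow> real ^ 'n"

definition tangent_space :: "('a, 'n::finite) chart set \<Rightarrow> 'a \<Rightarrow> ('a, 'n) tvec set" where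
  "tangent_space A x =
     {v. (\<forall>c\<in>A. \<forall>d\<in>A. x \<in> fst c \<and> x \<in> fst d \<longrightarrow>
            v d = frechet_derivative (snd d \<circ> chart_inv c) (at (snd c x)) (v c)) \<and>
         (\<forall>c. \<not> (c \<in> A \<and> x \<in> fst c) \<longrightarrow> v c = 0)}"

text \<open>The \<open>i\<close>-th coordinate vector at \<open>x\<close> of the chart \<open>c\<close>.\<close>

definition coord_vec ::
  "('a, 'n::finite) chart set \<Rightarrow> ('a, 'n) chart \<Rightarrow> 'a \<Rightarrow> 'n \<Rightarrow> ('a, 'n) tvec" where
  "coord_vec A c x i =
     (\<lambda>d. if d \<in> A \<and> x \<in> fst d
          then frechet_derivative (snd d \<circ> chart_inv c) (at (snd c x)) (axis i 1) else 0)"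

text \<open>\<open>b 1, \<dots>, b n\<close> is a basis of the vector space \<open>V\<close> of functions (with pointwise operations).\<close>

definition is_basis :: "('x \<Rightarrow> 'v::real_vector) set \<Rightarrow> nat \<Rightarrow> (nat \<Rightarrow> 'x \<Rightarrow> 'v) \<Rightarrow> bool" where
  "is_basis V n b \<longleftrightarrow>
     (\<forall>i\<in>{1..n}. b i \<in> V) \<and>
     (\<forall>v\<in>V. \<exists>!c :: nat \<Rightarrow> real. (\<forall>i. i \<notin> {1..n} \<longrightarrow> c i = 0) \<and>
                               v = (\<lambda>x. \<Sum>i=1..n. c i *\<^sub>R b i x))"


section \<open>Pseudo-Riemannian metrics\<close>

type_synonym ('a, 'n) metric = "'a \<Rightarrow> ('a, 'n) tvec \<Rightarrow> ('a, 'n) tvec \<Rightarrow> real"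

definition sign_matrix :: "nat \<Rightarrow> nat \<Rightarrow> nat \<Rightarrow> real" where
  "sign_matrix p i j = (if i \<noteq> j then 0 else if i \<le> p then 1 else -1)"

text \<open>Signature \<open>(p, q)\<close>: \<open>p\<close> positive and \<open>q\<close> negative directions.\<close>

definition pseudo_riemannian_metric ::
  "'a topology \<Rightarrow> ('a, 'n::finite) chart set \<Rightarrow> ('a, 'n) metric \<Rightarrow> nat \<Rightarrow> nat \<Rightarrow> bool" where
  "pseudo_riemannian_metric M A g p q \<longleftrightarrow>
     p + q = CARD('n) \<and>
     (\<forall>x\<in>topspace M.
        (\<forall>u\<in>tangent_space A x. \<forall>v\<in>tangent_space A x. g x u v = g x v u) \<and>
        (\<forall>u\<in>tangent_space A x. \<forall>v\<in>tangent_space A x. \<forall>w\<in>tangent_space A x. \<forall>a b.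
           g x (\<lambda>c. a *\<^sub>R u c + b *\<^sub>R v c) w = a * g x u w + b * g x v w) \<and>
        (\<forall>u\<in>tangent_space A x. (\<forall>v\<in>tangent_space A x. g x u v = 0) \<longrightarrow> u = (\<lambda>c. 0)) \<and>
        (\<exists>b. is_basis (tangent_space A x) (p + q) b \<and>
             (\<forall>i\<in>{1..p+q}. \<forall>j\<in>{1..p+q}. g x (b i) (b j) = sign_matrix p i j))) \<and>
     (\<forall>c\<in>A. \<forall>i j. smooth_on (snd c ` fst c)
        (\<lambda>y. let x = chart_inv c y in g x (coord_vec A c x i) (coord_vec A c x j)))"


section \<open>Inhomogeneous differential forms\<close>

text \<open>An element of the exterior algebra of the cotangent space at \<open>x\<close> is a function on lists of
  tangent vectors whose restriction to lists of length \<open>k\<close>, its component of degree \<open>k\<close>, is an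
  alternating \<open>k\<close>-linear map. Components of degree exceeding the dimension vanish automatically.
  Lists not consisting of tangent vectors at \<open>x\<close> are sent to 0.\<close>

type_synonym ('a, 'n) alt = "('a, 'n) tvec list \<Rightarrow> real"
type_synonym ('a, 'n) form = "'a \<Rightarrow> ('a, 'n) alt"

definition ext_cotangent :: "('a, 'n::finite) chart set \<Rightarrow> 'a \<Rightarrow> ('a, 'n) alt set" where
  "ext_cotangent A x =
     {\<alpha>. (\<forall>us ws. \<forall>v\<in>tangent_space A x. \<forall>w\<in>tangent_space A x. \<forall>a b.
            \<alpha> (us @ (\<lambda>c. a *\<^sub>R v c + b *\<^sub>R w c) # ws)
              = a * \<alpha> (us @ v # ws) + b * \<alpha> (us @ w # ws)) \<and>
         (\<forall>us vs ws v. \<alpha> (us @ v # vs @ v # ws) = 0) \<and>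
         (\<forall>vs. \<not> set vs \<subseteq> tangent_space A x \<longrightarrow> \<alpha> vs = 0)}"

definition cotangent_space :: "('a, 'n::finite) chart set \<Rightarrow> 'a \<Rightarrow> ('a, 'n) alt set" where
  "cotangent_space A x = {\<alpha> \<in> ext_cotangent A x. \<forall>vs. length vs \<noteq> 1 \<longrightarrow> \<alpha> vs = 0}"

text \<open>The smooth sections over \<open>U\<close> of the exterior bundle, extended by 0 outside \<open>U\<close>.\<close>

definition forms :: "('a, 'n::finite) chart set \<Rightarrow> 'a set \<Rightarrow> ('a, 'n) form set" where
  "forms A U =
     {f. (\<forall>x\<in>U. f x \<in> ext_cotangent A x) \<and>
         (\<forall>x vs. x \<notin> U \<longrightarrow> f x vs = 0) \<and>
         (\<forall>c\<in>A. \<forall>is. smooth_on (snd c ` (fst c \<inter> U))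
            (\<lambda>y. let x = chart_inv c y in f x (map (coord_vec A c x) is)))}"

definition unit_form :: "'a set \<Rightarrow> ('a, 'n) form" where
  "unit_form U x vs = (if x \<in> U \<and> vs = [] then 1 else 0)"

definition deg_part :: "nat \<Rightarrow> ('a, 'n) form \<Rightarrow> ('a, 'n) form" where
  "deg_part r f x vs = (if length vs = r then f x vs else 0)"

text \<open>The wedge product as the signed sum over all shuffles, i.e. over all ways of distributing
  the arguments over the two factors.\<close>

definition shuffle_sign :: "nat \<Rightarrow> nat set \<Rightarrow> real" where
  "shuffle_sign k S = (-1) ^ card {(i, j). i \<in> S \<and> j \<in> {..<k} - S \<and> j < i}"

definition wedge :: "('a, 'n) form \<Rightarrow> ('a, 'n) form \<Rightarrow> ('a, 'n) form" where
  "wedge f h x vs =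
     (\<Sum>S\<in>Pow {..<length vs}. shuffle_sign (length vs) S * f x (nths vs S) * h x (nths vs (- S)))"

definition contract :: "('a \<Rightarrow> ('a, 'n) tvec) \<Rightarrow> ('a, 'n) form \<Rightarrow> ('a, 'n) form" where
  "contract X f x vs = f x (X x # vs)"


section \<open>Orthonormal coframes\<close>

text \<open>The induced metric on covectors.\<close>

definition sharp ::
  "('a, 'n::finite) chart set \<Rightarrow> ('a, 'n) metric \<Rightarrow> 'a \<Rightarrow> ('a, 'n) alt \<Rightarrow> ('a, 'n) tvec" where
  "sharp A g x \<alpha> = (THE v. v \<in> tangent_space A x \<and> (\<forall>w\<in>tangent_space A x. g x v w = \<alpha> [w]))"

definition dual_metric ::
  "('a, 'n::finite) chart set \<Rightarrow> ('a, 'n) metric \<Rightarrow> 'a \<Rightarrow> ('a, 'n) alt \<Rightarrow> ('a, 'n) alt \<Rightarrow> real" where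
  "dual_metric A g x \<alpha> \<beta> = g x (sharp A g x \<alpha>) (sharp A g x \<beta>)"

definition coframe ::
  "('a, 'n::finite) chart set \<Rightarrow> 'a set \<Rightarrow> (nat \<Rightarrow> ('a, 'n) form) \<Rightarrow> bool" where
  "coframe A U e \<longleftrightarrow>
     (\<forall>i\<in>{1..CARD('n)}. e i \<in> forms A U) \<and>
     (\<forall>x\<in>U. is_basis (cotangent_space A x) CARD('n) (\<lambda>i. e i x))"

definition orthonormal_coframe ::
  "('a, 'n::finite) chart set \<Rightarrow> ('a, 'n) metric \<Rightarrow> nat \<Rightarrow> 'a set \<Rightarrow> (nat \<Rightarrow> ('a, 'n) form) \<Rightarrow> bool" where
  "orthonormal_coframe A g p U e \<longleftrightarrow>
     coframe A U e \<and>
     (\<forall>x\<in>U. \<forall>i\<in>{1..CARD('n)}. \<forall>j\<in>{1..CARD('n)}.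
        dual_metric A g x (e i x) (e j x) = sign_matrix p i j)"

definition dual_frame ::
  "('a, 'n::finite) chart set \<Rightarrow> (nat \<Rightarrow> ('a, 'n) form) \<Rightarrow> nat \<Rightarrow> 'a \<Rightarrow> ('a, 'n) tvec" where
  "dual_frame A e j x =
     (THE v. v \<in> tangent_space A x \<and> (\<forall>i\<in>{1..CARD('n)}. e i x [v] = (if i = j then 1 else 0)))"


section \<open>The Graf product\<close>

primrec contracted_wedge ::
  "('a, 'n::finite) chart set \<Rightarrow> ('a, 'n) metric \<Rightarrow> (nat \<Rightarrow> ('a, 'n) form) \<Rightarrow> nat \<Rightarrow>
   ('a, 'n) form \<Rightarrow> ('a, 'n) form \<Rightarrow> ('a, 'n) form" where
  "contracted_wedge A g e 0 = wedge"
| "contracted_wedge A g e (Suc l) =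
     (\<lambda>f h x vs. \<Sum>i=1..CARD('n). \<Sum>j=1..CARD('n).
        dual_metric A g x (e i x) (e j x) *
        contracted_wedge A g e l
          (contract (dual_frame A e i) f) (contract (dual_frame A e j) h) x vs)"

text \<open>The product of forms \<open>f\<close> and \<open>h\<close> of degrees \<open>r\<close> and \<open>s\<close>. If \<open>r > s\<close>, then \<open>f\<close> and \<open>h\<close>
  change places in the contracted wedge products.\<close>

definition graf_homogeneous ::
  "('a, 'n::finite) chart set \<Rightarrow> ('a, 'n) metric \<Rightarrow> (nat \<Rightarrow> ('a, 'n) form) \<Rightarrow> nat \<Rightarrow> nat \<Rightarrow>
   ('a, 'n) form \<Rightarrow> ('a, 'n) form \<Rightarrow> ('a, 'n) form" where
  "graf_homogeneous A g e r s f h x vs =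
     (if r \<le> s
      then \<Sum>l=0..r. (-1) ^ (l * (r - l) + l div 2) / fact l * contracted_wedge A g e l f h x vs
      else (-1) ^ (r * s) *
           (\<Sum>l=0..s. (-1) ^ (l * (s - l + 1) + l div 2) / fact l *
                     contracted_wedge A g e l h f x vs))"

definition graf ::
  "('a, 'n::finite) chart set \<Rightarrow> ('a, 'n) metric \<Rightarrow> (nat \<Rightarrow> ('a, 'n) form) \<Rightarrow>
   ('a, 'n) form \<Rightarrow> ('a, 'n) form \<Rightarrow> ('a, 'n) form" where
  "graf A g e f h x vs =
     (\<Sum>r=0..CARD('n). \<Sum>s=0..CARD('n).
        graf_homogeneous A g e r s (deg_part r f) (deg_part s h) x vs)"

definition volume_form :: "'a set \<Rightarrow> (nat \<Rightarrow> ('a, 'n::finite) form) \<Rightarrow> ('a, 'n) form" where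
  "volume_form U e = foldr (\<lambda>i f. wedge (e i) f) [1..<Suc CARD('n)] (unit_form U)"

text \<open>The elements \<open>p\<^sub>+\<close>, \<open>p\<^sub>-\<close>, the maps \<open>P\<^sub>+\<close>, \<open>P\<^sub>-\<close> and their images, for
  \<open>\<epsilon> = 1\<close> and \<open>\<epsilon> = -1\<close>.\<close>

definition p_elem :: "'a set \<Rightarrow> (nat \<Rightarrow> ('a, 'n::finite) form) \<Rightarrow> real \<Rightarrow> ('a, 'n) form" where
  "p_elem U e \<epsilon> x vs = (1 / 2) * (unit_form U x vs + \<epsilon> * volume_form U e x vs)"

definition P_map ::
  "('a, 'n::finite) chart set \<Rightarrow> ('a, 'n) metric \<Rightarrow> 'a set \<Rightarrow> (nat \<Rightarrow> ('a, 'n) form) \<Rightarrow> real \<Rightarrow>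
   ('a, 'n) form \<Rightarrow> ('a, 'n) form" where
  "P_map A g U e \<epsilon> f = graf A g e f (p_elem U e \<epsilon>)"

definition Gamma_plus ::
  "('a, 'n::finite) chart set \<Rightarrow> ('a, 'n) metric \<Rightarrow> 'a set \<Rightarrow> (nat \<Rightarrow> ('a, 'n) form) \<Rightarrow>
   ('a, 'n) form set" where
  "Gamma_plus A g U e = P_map A g U e 1 ` forms A U"

definition Gamma_minus ::
  "('a, 'n::finite) chart set \<Rightarrow> ('a, 'n) metric \<Rightarrow> 'a set \<Rightarrow> (nat \<Rightarrow> ('a, 'n) form) \<Rightarrow>
   ('a, 'n) form set" where
  "Gamma_minus A g U e = P_map A g U e (-1) ` forms A U"


section \<open>Internal direct sums of modules of forms\<close>

text \<open>Submodules over the ring of smooth functions on \<open>U\<close>.\<close>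

definition submodule_of_forms ::
  "('a, 'n::finite) chart set \<Rightarrow> 'a set \<Rightarrow> ('a, 'n) form set \<Rightarrow> bool" where
  "submodule_of_forms A U V \<longleftrightarrow>
     V \<subseteq> forms A U \<and> (\<lambda>x vs. 0) \<in> V \<and>
     (\<forall>f\<in>V. \<forall>h\<in>V. (\<lambda>x vs. f x vs + h x vs) \<in> V) \<and>
     (\<forall>k. smooth_fun A U k \<longrightarrow> (\<forall>f\<in>V. (\<lambda>x vs. k x * f x vs) \<in> V))"

definition forms_direct_sum ::
  "('a, 'n::finite) chart set \<Rightarrow> 'a set \<Rightarrow> ('a, 'n) form set \<Rightarrow> ('a, 'n) form set \<Rightarrow> bool" where
  "forms_direct_sum A U V W \<longleftrightarrow>
     submodule_of_forms A U V \<and> submodule_of_forms A U W \<and>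
     forms A U = {(\<lambda>x vs. f x vs + h x vs) | f h. f \<in> V \<and> h \<in> W} \<and>
     V \<inter> W = {\<lambda>x vs. 0}"


section \<open>The interior product is an antiderivation\<close>

lemma contract_degree_0:
  assumes "\<And>vs. vs \<noteq> [] \<Longrightarrow> f x vs = 0"
  shows "contract X f x vs = 0"
  using assms by (simp add: contract_def)

lemma Pow_lessThan_Suc_0:
  "Pow {..<Suc k} = (\<lambda>S. Suc ` S) ` Pow {..<k} \<union> (\<lambda>S. insert 0 (Suc ` S)) ` Pow {..<k}"
proof -
  have "{..<Suc k} = insert 0 (Suc ` {..<k})" by (rule lessThan_Suc_eq_insert_0)
  then show ?thesis by (simp add: Pow_insert image_Pow_surj[symmetric, OF refl] image_image)
qed

lemma inversions_Suc:
  assumes "S \<subseteq> {..<k}"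
  shows "card {(i, j). i \<in> insert 0 (Suc ` S) \<and> j \<in> {..<Suc k} - insert 0 (Suc ` S) \<and> j < i}
           = card {(i, j). i \<in> S \<and> j \<in> {..<k} - S \<and> j < i}" (is "card ?A = card ?C")
    and "card {(i, j). i \<in> Suc ` S \<and> j \<in> {..<Suc k} - Suc ` S \<and> j < i}
           = card S + card {(i, j). i \<in> S \<and> j \<in> {..<k} - S \<and> j < i}" (is "card ?B = _")
proof -
  let ?s = "\<lambda>(i, j). (Suc i, Suc j)"
  have inj: "inj_on ?s ?C" by (auto simp: inj_on_def)
  have A: "?A = ?s ` ?C"
    using assms by (force simp: image_iff less_Suc_eq_0_disj)
  show "card ?A = card ?C" unfolding A by (rule card_image[OF inj])
  have fS: "finite S" using assms finite_subset by blast
  have fC: "finite ?C" by (rule finite_subset[of _ "S \<times> {..<k}"]) (auto simp: fS)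
  have B: "?B = (\<lambda>i. (Suc i, 0)) ` S \<union> ?s ` ?C"
    using assms by (force simp: image_iff less_Suc_eq_0_disj)
  have "card ?B = card ((\<lambda>i. (Suc i, 0::nat)) ` S) + card (?s ` ?C)"
    unfolding B by (rule card_Un_disjoint[OF finite_imageI[OF fS] finite_imageI[OF fC]]) auto
  also have "\<dots> = card S + card ?C"
    by (simp add: card_image[OF inj] card_image inj_on_def)
  finally show "card ?B = card S + card ?C" .
qed

lemma contract_wedge:
  assumes f: "\<And>vs. length vs \<noteq> r \<Longrightarrow> f x vs = 0"
  shows "contract X (wedge f h) x vs =
           wedge (contract X f) h x vs + (-1) ^ r * wedge f (contract X h) x vs"
proof -
  define k where "k = length vs"
  let ?F = "\<lambda>S. shuffle_sign (Suc k) S * f x (nths (X x # vs) S) * h x (nths (X x # vs) (- S))"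
  have inj: "inj_on (\<lambda>S. Suc ` S) (Pow {..<k})" "inj_on (\<lambda>S. insert 0 (Suc ` S)) (Pow {..<k})"
    by (auto simp: inj_on_def inj_image_eq_iff insert_ident)
  have "contract X (wedge f h) x vs = sum ?F (Pow {..<Suc k})"
    by (simp add: contract_def wedge_def k_def)
  also have "\<dots> = sum ?F ((\<lambda>S. Suc ` S) ` Pow {..<k}) + sum ?F ((\<lambda>S. insert 0 (Suc ` S)) ` Pow {..<k})"
    unfolding Pow_lessThan_Suc_0 by (rule sum.union_disjoint) auto
  also have "\<dots> = (\<Sum>S\<in>Pow {..<k}. ?F (Suc ` S)) + (\<Sum>S\<in>Pow {..<k}. ?F (insert 0 (Suc ` S)))"
    by (simp add: sum.reindex[OF inj(1)] sum.reindex[OF inj(2)])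
  also have "(\<Sum>S\<in>Pow {..<k}. ?F (insert 0 (Suc ` S))) = wedge (contract X f) h x vs"
    unfolding wedge_def k_def[symmetric]
  proof (rule sum.cong[OF refl])
    fix S assume S: "S \<in> Pow {..<k}"
    have "shuffle_sign (Suc k) (insert 0 (Suc ` S)) = shuffle_sign k S"
      using S inversions_Suc(1)[of S k] unfolding shuffle_sign_def by simp
    moreover have "{j. Suc j \<in> insert 0 (Suc ` S)} = S" "{j. Suc j \<in> - insert 0 (Suc ` S)} = - S"
      by auto
    ultimately show "?F (insert 0 (Suc ` S)) =
        shuffle_sign k S * contract X f x (nths vs S) * h x (nths vs (- S))"
      unfolding nths_Cons by (simp add: contract_def)
  qed
  also have "(\<Sum>S\<in>Pow {..<k}. ?F (Suc ` S)) = (-1) ^ r * wedge f (contract X h) x vs"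
    unfolding wedge_def k_def[symmetric] sum_distrib_left
  proof (rule sum.cong[OF refl])
    fix S assume S: "S \<in> Pow {..<k}"
    have len: "length (nths vs S) = card S"
      using S by (auto simp: length_nths k_def intro!: arg_cong[where f = card])
    have "?F (Suc ` S) = (-1) ^ card S * (shuffle_sign k S * f x (nths vs S) * contract X h x (nths vs (- S)))"
    proof -
      have "shuffle_sign (Suc k) (Suc ` S) = (-1) ^ card S * shuffle_sign k S"
        using S inversions_Suc(2)[of S k] unfolding shuffle_sign_def by (simp add: power_add)
      moreover have "{j. Suc j \<in> Suc ` S} = S" "{j. Suc j \<in> - (Suc ` S)} = - S"
        by auto
      ultimately show ?thesis
        unfolding nths_Cons by (simp add: contract_def)
    qed
    also have "\<dots> = (-1) ^ r * (shuffle_sign k S * f x (nths vs S) * contract X h x (nths vs (- S)))"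
      using f[of "nths vs S"] len by (cases "card S = r") auto
    finally show "?F (Suc ` S) = \<dots>" .
  qed
  finally show ?thesis by simp
qed

end

theory Submission
  imports Defs
begin

text \<open>The Hodge operator is Graf multiplication by the volume element \<open>\<nu>\<close> from the right, and
  \<open>P\<^sub>\<plusminus> = (id \<plusminus> \<star>) / 2\<close>. Every form is the sum of its images under \<open>P\<^sub>+\<close> and \<open>P\<^sub>-\<close>. If \<open>\<star>\<close> is an
  involution, these images are its eigenspaces for \<open>1\<close> and \<open>-1\<close>, which intersect in zero. So the
  theorem amounts to \<open>\<star>\<star> = id\<close>, together with the fact that \<open>\<star>\<close> preserves smooth sections.

  The identity \<open>\<star>\<star> = id\<close> is a statement about the exterior algebra at a single point. In a frame
  \<open>E\<^sub>i\<close> dual to the coframe \<open>\<theta>\<^sup>i\<close>, with \<open>\<epsilon>\<^sub>i = g\<^sup>i\<^sup>i\<close>, only the terms with \<open>l = r\<close> survive in the Graf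
  product of an \<open>r\<close>-form with \<open>\<nu>\<close>, because the wedge product of a form of positive degree with
  \<open>\<nu>\<close> vanishes. What remains is a full contraction of the form against \<open>\<nu>\<close>
  (\<open>graf_sum_volume\<close>). By induction on the number of contracted indices one obtains the two
  relations
    \<open>\<star>(\<theta>\<^sup>j \<and> \<alpha>) = \<epsilon>\<^sub>j \<iota>\<^sub>j (\<star>\<alpha>)\<close> and \<open>\<theta>\<^sup>j \<and> \<star>\<alpha> = \<epsilon>\<^sub>j \<star>(\<iota>\<^sub>j \<alpha>)\<close>
  (\<open>hodge_ext\<close>, \<open>ext_hodge\<close>). They show that \<open>\<star>\<star>\<close> commutes with every operator \<open>\<theta>\<^sup>j \<and> _\<close>. Since
  these operators generate the whole algebra from the unit, by Euler's identity
  \<open>\<Sum>\<^sub>i \<theta>\<^sup>i \<and> \<iota>\<^sub>i \<alpha> = (deg \<alpha>) \<alpha>\<close>, it is enough to know \<open>\<star>\<star>1 = \<star>\<nu>\<close>. Here \<open>\<star>\<nu>\<close> is the constant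
  \<open>(-1)\<^sup>q (-1)\<^sup>[\<^sup>n\<^sup>/\<^sup>2\<^sup>]\<close>, and it equals \<open>1\<close> exactly if \<open>p - q\<close> is congruent to 0 or 1 modulo 4
  (\<open>hodge_volume\<close>, \<open>volume_square_sign\<close>).

  Smoothness is obtained structurally: smooth sections are closed under wedge products and under
  contraction with the dual frame, whose coordinates are smooth by Cramer's rule
  (\<open>frame_coords_smooth\<close>). The dual frame exists because the vectors \<open>\<epsilon>\<^sub>j e\<^sup>j\<^sup>\<sharp>\<close> form one
  (\<open>dual_frame_properties\<close>), so no matrix has to be inverted at that point.\<close>

section \<open>Calculus of smooth real functions\<close>

text \<open>The derivatives of \<open>f\<close> and \<open>h\<close> agree on \<open>S\<close> because \<open>S\<close> is open, so the induction passes to the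
  derivatives.\<close>

lemma C_k_on_cong:
  assumes "open S" "\<And>x. x \<in> S \<Longrightarrow> f x = h x" "C_k_on k S f"
  shows "C_k_on k S h"
  using assms(2,3)
proof (induction k arbitrary: f h)
  case 0
  then show ?case by (simp cong: continuous_on_cong)
next
  case (Suc k)
  have der: "(h has_derivative frechet_derivative f (at x)) (at x)" if "x \<in> S" for x
  proof (rule has_derivative_transform_within_open)
    show "(f has_derivative frechet_derivative f (at x)) (at x)"
      using Suc.prems(2) that by (simp add: frechet_derivative_works[symmetric])
  qed (use assms(1) Suc.prems(1) that in auto)
  have "C_k_on k S (\<lambda>x. frechet_derivative h (at x) v)" for v
  proof (rule Suc.IH)
    show "C_k_on k S (\<lambda>x. frechet_derivative f (at x) v)" using Suc.prems(2) by simp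
    show "frechet_derivative f (at x) v = frechet_derivative h (at x) v" if "x \<in> S" for x
      using frechet_derivative_at[OF der[OF that]] by simp
  qed
  then show ?case using der by (auto simp: differentiable_def)
qed

lemma C_k_on_Suc_imp: "C_k_on (Suc k) S f \<Longrightarrow> C_k_on k S f"
proof (induction k arbitrary: f)
  case 0
  then show ?case
    by (auto intro!: continuous_at_imp_continuous_on differentiable_imp_continuous_within)
next
  case (Suc k)
  then show ?case by simp
qed

lemma C_k_on_const: "C_k_on k S (\<lambda>x. c)"
  by (induction k arbitrary: c) auto

lemma C_k_on_SucI:
  assumes "open S" "\<And>x. x \<in> S \<Longrightarrow> (f has_derivative D x) (at x)"
    and "\<And>v. C_k_on k S (\<lambda>x. D x v)"
  shows "C_k_on (Suc k) S f"
  using assms(2) C_k_on_cong[OF assms(1) _ assms(3)] frechet_derivative_at[OF assms(2)]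
  by (auto simp: differentiable_def)

lemma C_k_on_SucD:
  "C_k_on (Suc k) S f \<Longrightarrow> x \<in> S \<Longrightarrow> (f has_derivative frechet_derivative f (at x)) (at x)"
  by (simp add: frechet_derivative_works[symmetric])

lemma C_k_on_add:
  fixes f h :: "'v::real_normed_vector \<Rightarrow> real"
  assumes "open S" "C_k_on k S f" "C_k_on k S h"
  shows "C_k_on k S (\<lambda>x. f x + h x)"
  using assms(2,3)
proof (induction k arbitrary: f h)
  case 0
  then show ?case by (simp add: continuous_on_add)
next
  case (Suc k)
  show ?case
    by (rule C_k_on_SucI[OF assms(1) has_derivative_add[OF C_k_on_SucD C_k_on_SucD]])
      (use Suc in auto)
qed

lemma C_k_on_mult:
  fixes f h :: "'v::real_normed_vector \<Rightarrow> real"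
  assumes "open S" "C_k_on k S f" "C_k_on k S h"
  shows "C_k_on k S (\<lambda>x. f x * h x)"
  using assms(2,3)
proof (induction k arbitrary: f h)
  case 0
  then show ?case by (simp add: continuous_on_mult)
next
  case (Suc k)
  show ?case
  proof (rule C_k_on_SucI[OF assms(1) has_derivative_mult[OF C_k_on_SucD C_k_on_SucD]])
    fix v
    have "C_k_on k S (\<lambda>x. frechet_derivative f (at x) v)"
      "C_k_on k S (\<lambda>x. frechet_derivative h (at x) v)" using Suc.prems by auto
    then show "C_k_on k S
        (\<lambda>x. f x * frechet_derivative h (at x) v + frechet_derivative f (at x) v * h x)"
      using Suc.prems[THEN C_k_on_Suc_imp] by (intro C_k_on_add Suc.IH assms(1))
  qed (use Suc.prems in auto)
qed

lemma C_k_on_inverse: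
  fixes f :: "'v::real_normed_vector \<Rightarrow> real"
  assumes "open S" "C_k_on k S f" "\<And>x. x \<in> S \<Longrightarrow> f x \<noteq> 0"
  shows "C_k_on k S (\<lambda>x. inverse (f x))"
  using assms(2)
proof (induction k)
  case 0
  then show ?case using assms(3) by (simp add: continuous_on_inverse)
next
  case (Suc k)
  show ?case
  proof (rule C_k_on_SucI[OF assms(1) Deriv.has_derivative_inverse[OF _ C_k_on_SucD]])
    fix v
    have 1: "C_k_on k S (\<lambda>x. inverse (f x))"
      by (rule Suc.IH[OF C_k_on_Suc_imp[OF Suc.prems]])
    have 2: "C_k_on k S (\<lambda>x. frechet_derivative f (at x) v)" using Suc.prems by auto
    have "C_k_on k S (\<lambda>x. (-1) * (inverse (f x) * frechet_derivative f (at x) v * inverse (f x)))"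
      by (intro C_k_on_mult C_k_on_const assms(1) 1 2)
    then show "C_k_on k S
        (\<lambda>x. - (inverse (f x) * frechet_derivative f (at x) v * inverse (f x)))"
      by simp
  qed (use assms(3) Suc.prems in blast)+
qed

lemma smooth_on_cong:
  "open S \<Longrightarrow> (\<And>x. x \<in> S \<Longrightarrow> f x = h x) \<Longrightarrow> smooth_on S f \<Longrightarrow> smooth_on S h"
  unfolding smooth_on_def using C_k_on_cong by blast

lemma smooth_on_const: "smooth_on S (\<lambda>x. c)"
  by (simp add: smooth_on_def C_k_on_const)

lemma smooth_on_add:
  fixes f h :: "'v::real_normed_vector \<Rightarrow> real"
  shows "open S \<Longrightarrow> smooth_on S f \<Longrightarrow> smooth_on S h \<Longrightarrow> smooth_on S (\<lambda>x. f x + h x)"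
  by (simp add: smooth_on_def C_k_on_add)

lemma smooth_on_mult:
  fixes f h :: "'v::real_normed_vector \<Rightarrow> real"
  shows "open S \<Longrightarrow> smooth_on S f \<Longrightarrow> smooth_on S h \<Longrightarrow> smooth_on S (\<lambda>x. f x * h x)"
  by (simp add: smooth_on_def C_k_on_mult)

lemma smooth_on_divide:
  fixes f h :: "'v::real_normed_vector \<Rightarrow> real"
  assumes "open S" "smooth_on S f" "smooth_on S h" "\<And>x. x \<in> S \<Longrightarrow> h x \<noteq> 0"
  shows "smooth_on S (\<lambda>x. f x / h x)"
proof -
  have "smooth_on S (\<lambda>x. inverse (h x))"
    using C_k_on_inverse[OF assms(1) _ assms(4)] assms(3) by (simp add: smooth_on_def)
  then show ?thesis unfolding divide_inverse by (rule smooth_on_mult[OF assms(1,2)])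
qed

lemma smooth_on_sum:
  fixes f :: "'i \<Rightarrow> 'v::real_normed_vector \<Rightarrow> real"
  assumes "open S" "\<And>i. i \<in> I \<Longrightarrow> smooth_on S (f i)"
  shows "smooth_on S (\<lambda>x. \<Sum>i\<in>I. f i x)"
  using assms(2)
  by (induction I rule: infinite_finite_induct) (auto intro: smooth_on_const smooth_on_add assms(1))

lemma smooth_on_prod:
  fixes f :: "'i \<Rightarrow> 'v::real_normed_vector \<Rightarrow> real"
  assumes "open S" "\<And>i. i \<in> I \<Longrightarrow> smooth_on S (f i)"
  shows "smooth_on S (\<lambda>x. \<Prod>i\<in>I. f i x)"
  using assms(2)
  by (induction I rule: infinite_finite_induct) (auto intro: smooth_on_const smooth_on_mult assms(1))

lemma smooth_on_det:
  fixes m :: "'v::real_normed_vector \<Rightarrow> real ^ 'n ^ 'n"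
  assumes "open S" "\<And>i j. smooth_on S (\<lambda>x. m x $ i $ j)"
  shows "smooth_on S (\<lambda>x. det (m x))"
  unfolding det_def
  by (intro smooth_on_sum smooth_on_mult smooth_on_prod smooth_on_const assms)

section \<open>Charts and tangent vectors\<close>

context
  fixes M :: "'a topology" and A :: "('a, 'n::finite) chart set"
  assumes manifold: "smooth_manifold M A"
begin

lemma chart_homeomorphic:
  assumes "c \<in> A"
  shows "openin M (fst c)" "open (snd c ` fst c)"
    "homeomorphic_map (subtopology M (fst c)) (top_of_set (snd c ` fst c)) (snd c)"
  using manifold assms by (auto simp: smooth_manifold_def smooth_atlas_def is_chart_def)

lemma chart_inv_eq: "c \<in> A \<Longrightarrow> x \<in> fst c \<Longrightarrow> chart_inv c (snd c x) = x"
  using homeomorphic_imp_injective_map[OF chart_homeomorphic(3)[of c]]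
    openin_subset[OF chart_homeomorphic(1)[of c]]
  unfolding chart_inv_def by (simp add: Int_absorb1)

lemma open_chart_image:
  assumes "c \<in> A" "openin M V"
  shows "open (snd c ` (fst c \<inter> V))"
proof -
  have "openin (subtopology M (fst c)) (fst c \<inter> V)"
    using assms(2) by (metis inf_commute openin_subtopology)
  then have "openin (top_of_set (snd c ` fst c)) (snd c ` (fst c \<inter> V))"
    using homeomorphic_imp_open_map[OF chart_homeomorphic(3)[OF assms(1)]]
    unfolding open_map_def by blast
  then show ?thesis using chart_homeomorphic(2)[OF assms(1)] openin_open_eq by blast
qed

lemma transition_has_derivative:
  assumes "c \<in> A" "d \<in> A" "x \<in> fst c" "x \<in> fst d"
  shows "((snd d \<circ> chart_inv c) has_derivative
           frechet_derivative (snd d \<circ> chart_inv c) (at (snd c x))) (at (snd c x))"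
proof -
  have "C_k_on (Suc 0) (snd c ` (fst c \<inter> fst d)) (snd d \<circ> chart_inv c)"
    using manifold assms unfolding smooth_manifold_def smooth_atlas_def smooth_on_def by blast
  then show ?thesis by (rule C_k_on_SucD) (use assms in auto)
qed

lemma tangent_space_comb:
  assumes "v \<in> tangent_space A x" "w \<in> tangent_space A x"
  shows "(\<lambda>c. a *\<^sub>R v c + b *\<^sub>R w c) \<in> tangent_space A x"
proof -
  have lin: "linear (frechet_derivative (snd d \<circ> chart_inv c) (at (snd c x)))"
    if "c \<in> A" "d \<in> A" "x \<in> fst c" "x \<in> fst d" for c d
    using transition_has_derivative[OF that] by (simp add: has_derivative_linear)
  show ?thesis
    unfolding tangent_space_def
  proof (intro CollectI conjI ballI allI impI)
    fix c d assume "c \<in> A" "d \<in> A" "x \<in> fst c \<and> x \<in> fst d"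
    then have "v d = frechet_derivative (snd d \<circ> chart_inv c) (at (snd c x)) (v c)"
      "w d = frechet_derivative (snd d \<circ> chart_inv c) (at (snd c x)) (w c)"
      and lin': "linear (frechet_derivative (snd d \<circ> chart_inv c) (at (snd c x)))"
      using assms lin unfolding tangent_space_def by blast+
    then show "a *\<^sub>R v d + b *\<^sub>R w d =
        frechet_derivative (snd d \<circ> chart_inv c) (at (snd c x)) (a *\<^sub>R v c + b *\<^sub>R w c)"
      by (simp only: linear_add[OF lin'] linear_scale[OF lin'])
  next
    fix c assume "\<not> (c \<in> A \<and> x \<in> fst c)"
    then have "v c = 0" "w c = 0" using assms unfolding tangent_space_def by blast+
    then show "a *\<^sub>R v c + b *\<^sub>R w c = 0" by simp
  qed
qed

text \<open>The compatibility of the coordinates of \<open>\<partial>\<^sub>i\<close> in two charts \<open>d\<close>, \<open>d'\<close> is the chain rule for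
  the factorisation of the transition from \<open>c\<close> to \<open>d'\<close> through \<open>d\<close>.\<close>

lemma coord_vec_tangent:
  assumes "c \<in> A" "x \<in> fst c"
  shows "coord_vec A c x i \<in> tangent_space A x"
proof -
  have eq: "frechet_derivative (snd d' \<circ> chart_inv c) (at (snd c x)) (axis i 1) =
        frechet_derivative (snd d' \<circ> chart_inv d) (at (snd d x))
          (frechet_derivative (snd d \<circ> chart_inv c) (at (snd c x)) (axis i 1))"
    if d: "d \<in> A" "x \<in> fst d" "d' \<in> A" "x \<in> fst d'" for d d'
  proof -
    have pt: "(snd d \<circ> chart_inv c) (snd c x) = snd d x"
      using assms by (simp add: chart_inv_eq)
    have "((snd d' \<circ> chart_inv d) \<circ> (snd d \<circ> chart_inv c) has_derivative
        (frechet_derivative (snd d' \<circ> chart_inv d) (at (snd d x)) \<circ>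
         frechet_derivative (snd d \<circ> chart_inv c) (at (snd c x)))) (at (snd c x))"
      by (rule diff_chain_at) (use transition_has_derivative assms d pt in auto)
    then have "((snd d' \<circ> chart_inv c) has_derivative
        (frechet_derivative (snd d' \<circ> chart_inv d) (at (snd d x)) \<circ>
         frechet_derivative (snd d \<circ> chart_inv c) (at (snd c x)))) (at (snd c x))"
      by (rule has_derivative_transform_within_open
            [OF _ open_chart_image[OF assms(1) chart_homeomorphic(1)[OF d(1)]]])
        (use assms d in \<open>auto simp: chart_inv_eq\<close>)
    from frechet_derivative_at[OF this] show ?thesis by (simp add: fun_eq_iff)
  qed
  show ?thesis
    unfolding tangent_space_def coord_vec_def
  proof (intro CollectI conjI ballI allI impI, goal_cases)
    case (1 d d')
    then show ?case using eq[of d d'] by (simp only: simp_thms if_True)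
  next
    case (2 d)
    then show ?case by (simp only: if_False)
  qed
qed

text \<open>A tangent vector is determined by its coordinates in one chart \<open>c\<close>: the compatibility condition
  computes all others from them, linearly.\<close>

lemma tangent_vector_coords:
  assumes "c \<in> A" "x \<in> fst c" "v \<in> tangent_space A x"
  shows "v = (\<lambda>d. \<Sum>k\<in>UNIV. (v c $ k) *\<^sub>R coord_vec A c x k d)"
proof
  fix d
  show "v d = (\<Sum>k\<in>UNIV. (v c $ k) *\<^sub>R coord_vec A c x k d)"
  proof (cases "d \<in> A \<and> x \<in> fst d")
    case True
    have lin: "linear (frechet_derivative (snd d \<circ> chart_inv c) (at (snd c x)))"
      using transition_has_derivative[of c d x] True assms by (auto simp: has_derivative_linear)
    have "v d = frechet_derivative (snd d \<circ> chart_inv c) (at (snd c x)) (v c)"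
      using assms True unfolding tangent_space_def by blast
    also have "v c = (\<Sum>k\<in>UNIV. (v c $ k) *\<^sub>R axis k 1)"
      using basis_expansion[of "v c"] by (simp add: scalar_mult_eq_scaleR)
    finally have "v d = (\<Sum>k\<in>UNIV. (v c $ k) *\<^sub>R
        frechet_derivative (snd d \<circ> chart_inv c) (at (snd c x)) (axis k 1))"
      by (simp only: linear_sum[OF lin] linear_scale[OF lin])
    then show ?thesis using True by (simp only: coord_vec_def simp_thms if_True)
  next
    case False
    then have "v d = 0" using assms unfolding tangent_space_def by blast
    then show ?thesis
      by (simp only: coord_vec_def False if_False scaleR_zero_right sum.neutral_const)
  qed
qed

end

section \<open>The exterior algebra at a point\<close>

text \<open>The exterior algebra of the dual of \<open>T\<close>. It is kept separate from the manifold so that the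
  algebra below can be carried out for an arbitrary space of vectors.\<close>

definition alternating_forms :: "('a, 'n::finite) tvec set \<Rightarrow> ('a, 'n) alt set" where
  "alternating_forms T =
     {\<alpha>. (\<forall>us ws. \<forall>v\<in>T. \<forall>w\<in>T. \<forall>a b.
            \<alpha> (us @ (\<lambda>c. a *\<^sub>R v c + b *\<^sub>R w c) # ws) = a * \<alpha> (us @ v # ws) + b * \<alpha> (us @ w # ws)) \<and>
         (\<forall>us vs ws v. \<alpha> (us @ v # vs @ v # ws) = 0) \<and>
         (\<forall>vs. \<not> set vs \<subseteq> T \<longrightarrow> \<alpha> vs = 0)}"

lemma ext_cotangent_eq: "ext_cotangent A x = alternating_forms (tangent_space A x)"
  by (simp add: ext_cotangent_def alternating_forms_def)

lemma alternating_formsI: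
  assumes "\<And>us ws v w a b. v \<in> T \<Longrightarrow> w \<in> T \<Longrightarrow>
      \<alpha> (us @ (\<lambda>c. a *\<^sub>R v c + b *\<^sub>R w c) # ws) = a * \<alpha> (us @ v # ws) + b * \<alpha> (us @ w # ws)"
    and "\<And>us vs ws v. \<alpha> (us @ v # vs @ v # ws) = 0"
    and "\<And>vs. \<not> set vs \<subseteq> T \<Longrightarrow> \<alpha> vs = 0"
  shows "\<alpha> \<in> alternating_forms T"
  using assms unfolding alternating_forms_def by blast

lemma alternating_linear:
  assumes "\<alpha> \<in> alternating_forms T" "v \<in> T" "w \<in> T"
  shows "\<alpha> (us @ (\<lambda>c. a *\<^sub>R v c + b *\<^sub>R w c) # ws) = a * \<alpha> (us @ v # ws) + b * \<alpha> (us @ w # ws)"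
  using assms unfolding alternating_forms_def by blast

lemma alternating_repeated: "\<alpha> \<in> alternating_forms T \<Longrightarrow> \<alpha> (us @ v # vs @ v # ws) = 0"
  unfolding alternating_forms_def by blast

lemma alternating_outside: "\<alpha> \<in> alternating_forms T \<Longrightarrow> \<not> set vs \<subseteq> T \<Longrightarrow> \<alpha> vs = 0"
  unfolding alternating_forms_def by blast

definition contraction :: "('a, 'n::finite) tvec \<Rightarrow> ('a, 'n) alt \<Rightarrow> ('a, 'n) alt" where
  "contraction v \<alpha> = (\<lambda>vs. \<alpha> (v # vs))"

text \<open>The sign that an antiderivation picks up when it passes \<open>\<alpha>\<close>, for forms of mixed degree.\<close>

definition grade_involution :: "('a, 'n::finite) alt \<Rightarrow> ('a, 'n) alt" where
  "grade_involution \<alpha> = (\<lambda>vs. (-1) ^ length vs * \<alpha> vs)"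

definition alt_wedge :: "('a, 'n::finite) alt \<Rightarrow> ('a, 'n) alt \<Rightarrow> ('a, 'n) alt" where
  "alt_wedge \<alpha> \<beta> = (\<lambda>vs. \<Sum>S\<in>Pow {..<length vs}.
     shuffle_sign (length vs) S * \<alpha> (nths vs S) * \<beta> (nths vs (- S)))"

definition alt_unit :: "('a, 'n::finite) alt" where
  "alt_unit = (\<lambda>vs. if vs = [] then 1 else 0)"

lemma wedge_eq_alt_wedge: "wedge f h x = alt_wedge (f x) (h x)"
  by (simp add: fun_eq_iff wedge_def alt_wedge_def)

lemma contract_eq_contraction: "contract X f x = contraction (X x) (f x)"
  by (simp add: fun_eq_iff contract_def contraction_def)

lemma alternating_contraction: "\<alpha> \<in> alternating_forms T \<Longrightarrow> contraction v \<alpha> \<in> alternating_forms T"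
proof (rule alternating_formsI)
  assume \<alpha>: "\<alpha> \<in> alternating_forms T"
  show "contraction v \<alpha> (us @ (\<lambda>c. a *\<^sub>R w c + b *\<^sub>R w' c) # ws) =
      a * contraction v \<alpha> (us @ w # ws) + b * contraction v \<alpha> (us @ w' # ws)"
    if "w \<in> T" "w' \<in> T" for us ws w w' a b
    using alternating_linear[OF \<alpha> that, of "v # us"] by (simp add: contraction_def)
  show "contraction v \<alpha> (us @ w # vs @ w # ws) = 0" for us vs ws w
    using alternating_repeated[OF \<alpha>, of "v # us"] by (simp add: contraction_def)
  show "contraction v \<alpha> vs = 0" if "\<not> set vs \<subseteq> T" for vs
    using alternating_outside[OF \<alpha>] that by (simp add: contraction_def)
qed

lemma alternating_zero: "(\<lambda>vs. 0) \<in> alternating_forms T"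
  by (rule alternating_formsI) auto

lemma alternating_scale: "\<alpha> \<in> alternating_forms T \<Longrightarrow> (\<lambda>vs. k * \<alpha> vs) \<in> alternating_forms T"
  by (rule alternating_formsI)
    (auto simp: alternating_linear alternating_repeated alternating_outside algebra_simps)

lemma alternating_add:
  "\<alpha> \<in> alternating_forms T \<Longrightarrow> \<beta> \<in> alternating_forms T \<Longrightarrow>
   (\<lambda>vs. \<alpha> vs + \<beta> vs) \<in> alternating_forms T"
  by (rule alternating_formsI)
    (auto simp: alternating_linear alternating_repeated alternating_outside algebra_simps)

lemma alternating_sum:
  "(\<And>i. i \<in> I \<Longrightarrow> \<alpha> i \<in> alternating_forms T) \<Longrightarrow> (\<lambda>vs. \<Sum>i\<in>I. \<alpha> i vs) \<in> alternating_forms T"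
  by (induction I rule: infinite_finite_induct) (auto simp: alternating_zero intro: alternating_add)

lemma alternating_graded_scale:
  "\<alpha> \<in> alternating_forms T \<Longrightarrow> (\<lambda>vs. k (length vs) * \<alpha> vs) \<in> alternating_forms T"
  by (rule alternating_formsI)
    (auto simp: alternating_linear alternating_repeated alternating_outside algebra_simps)

lemma alternating_unit: "alt_unit \<in> alternating_forms T"
  by (rule alternating_formsI) (auto simp: alt_unit_def)

lemma alt_wedge_scale_left: "alt_wedge (\<lambda>us. k * \<alpha> us) \<beta> = (\<lambda>vs. k * alt_wedge \<alpha> \<beta> vs)"
  by (simp add: alt_wedge_def sum_distrib_left mult_ac)

lemma alt_wedge_scale_right: "alt_wedge \<alpha> (\<lambda>us. k * \<beta> us) = (\<lambda>vs. k * alt_wedge \<alpha> \<beta> vs)"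
  by (simp add: alt_wedge_def sum_distrib_left mult_ac)

lemma alt_wedge_minus_left: "alt_wedge (\<lambda>us. - \<alpha> us) \<beta> = (\<lambda>vs. - alt_wedge \<alpha> \<beta> vs)"
  by (simp add: alt_wedge_def sum_negf)

lemma alt_wedge_add_left:
  "alt_wedge (\<lambda>us. \<alpha> us + \<alpha>' us) \<beta> = (\<lambda>vs. alt_wedge \<alpha> \<beta> vs + alt_wedge \<alpha>' \<beta> vs)"
  by (simp add: alt_wedge_def sum.distrib algebra_simps)

lemma alt_wedge_add_right:
  "alt_wedge \<alpha> (\<lambda>us. \<beta> us + \<beta>' us) = (\<lambda>vs. alt_wedge \<alpha> \<beta> vs + alt_wedge \<alpha> \<beta>' vs)"
  by (simp add: alt_wedge_def sum.distrib algebra_simps)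

lemma alt_wedge_zero_left [simp]: "alt_wedge (\<lambda>us. 0) \<beta> = (\<lambda>vs. 0)"
  by (simp add: alt_wedge_def)

lemma alt_wedge_zero_right [simp]: "alt_wedge \<alpha> (\<lambda>us. 0) = (\<lambda>vs. 0)"
  by (simp add: alt_wedge_def)

lemma alt_wedge_sum_left:
  "alt_wedge (\<lambda>us. \<Sum>i\<in>I. \<alpha> i us) \<beta> = (\<lambda>vs. \<Sum>i\<in>I. alt_wedge (\<alpha> i) \<beta> vs)"
  by (induction I rule: infinite_finite_induct) (auto simp: alt_wedge_add_left)

lemma alt_wedge_sum_right:
  "alt_wedge \<alpha> (\<lambda>us. \<Sum>i\<in>I. \<beta> i us) = (\<lambda>vs. \<Sum>i\<in>I. alt_wedge \<alpha> (\<beta> i) vs)"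
  by (induction I rule: infinite_finite_induct) (auto simp: alt_wedge_add_right)

lemma alt_wedge_Nil [simp]: "alt_wedge \<alpha> \<beta> [] = \<alpha> [] * \<beta> []"
  by (simp add: alt_wedge_def shuffle_sign_def)

lemma alt_wedge_cong_left:
  assumes "\<And>us. length us \<le> length vs \<Longrightarrow> \<alpha> us = \<alpha>' us"
  shows "alt_wedge \<alpha> \<beta> vs = alt_wedge \<alpha>' \<beta> vs"
proof -
  have "length (nths vs S) \<le> length vs" for S
    unfolding length_nths by (rule order.trans[OF card_mono[of "{..<length vs}"]]) auto
  then show ?thesis unfolding alt_wedge_def using assms by simp
qed

text \<open>Contraction is an antiderivation, for forms of mixed degree. Together with \<open>alt_wedge_Nil\<close> this
  is a recursive description of the wedge product along the list of arguments, and everything below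
  uses this description in place of the sum over shuffles. A list of arguments of bounded length
  sees only finitely many homogeneous components of \<open>\<alpha>\<close>, so the homogeneous case applies.\<close>

lemma alt_wedge_Cons:
  "alt_wedge \<alpha> \<beta> (w # vs) =
     alt_wedge (contraction w \<alpha>) \<beta> vs + alt_wedge (grade_involution \<alpha>) (contraction w \<beta>) vs"
proof -
  define N where "N = Suc (length vs)"
  define part where "part r us = (if length us = r then \<alpha> us else 0)" for r us
  have part_sum: "(\<Sum>r\<le>N. k r * part r us) = k (length us) * \<alpha> us" if "length us \<le> N" for us k
  proof -
    have "(\<Sum>r\<le>N. k r * part r us) = (\<Sum>r\<in>{length us}. k r * part r us)"
      using that by (intro sum.mono_neutral_right) (auto simp: part_def)
    then show ?thesis by (simp add: part_def)
  qed
  have homogeneous: "alt_wedge (part r) \<beta> (w # vs) =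
      alt_wedge (contraction w (part r)) \<beta> vs + alt_wedge (\<lambda>us. (-1) ^ r * part r us) (contraction w \<beta>) vs" for r
  proof -
    have "contract (\<lambda>_. w) (wedge (\<lambda>_. part r) (\<lambda>_. \<beta>)) undefined vs =
        wedge (contract (\<lambda>_. w) (\<lambda>_. part r)) (\<lambda>_. \<beta>) undefined vs +
        (-1) ^ r * wedge (\<lambda>_. part r) (contract (\<lambda>_. w) (\<lambda>_. \<beta>)) undefined vs"
      by (rule contract_wedge) (simp add: part_def)
    then show ?thesis
      unfolding wedge_eq_alt_wedge contract_eq_contraction alt_wedge_scale_left
      by (simp add: contraction_def wedge_eq_alt_wedge)
  qed
  have "alt_wedge \<alpha> \<beta> (w # vs) = alt_wedge (\<lambda>us. \<Sum>r\<le>N. part r us) \<beta> (w # vs)"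
    by (rule alt_wedge_cong_left) (use part_sum[where k = "\<lambda>_. 1"] in \<open>simp add: N_def\<close>)
  also have "\<dots> = (\<Sum>r\<le>N. alt_wedge (contraction w (part r)) \<beta> vs) +
      (\<Sum>r\<le>N. alt_wedge (\<lambda>us. (-1) ^ r * part r us) (contraction w \<beta>) vs)"
    by (simp add: alt_wedge_sum_left homogeneous sum.distrib)
  also have "(\<Sum>r\<le>N. alt_wedge (contraction w (part r)) \<beta> vs) =
      alt_wedge (\<lambda>us. \<Sum>r\<le>N. contraction w (part r) us) \<beta> vs"
    by (simp add: alt_wedge_sum_left)
  also have "\<dots> = alt_wedge (contraction w \<alpha>) \<beta> vs"
    by (rule alt_wedge_cong_left)
      (use part_sum[where k = "\<lambda>_. 1"] in \<open>simp add: N_def contraction_def\<close>)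
  also have "(\<Sum>r\<le>N. alt_wedge (\<lambda>us. (-1) ^ r * part r us) (contraction w \<beta>) vs) =
      alt_wedge (\<lambda>us. \<Sum>r\<le>N. (-1) ^ r * part r us) (contraction w \<beta>) vs"
    by (simp only: alt_wedge_sum_left)
  also have "\<dots> = alt_wedge (grade_involution \<alpha>) (contraction w \<beta>) vs"
    by (rule alt_wedge_cong_left)
      (use part_sum[where k = "\<lambda>r. (-1) ^ r"] in \<open>simp add: N_def grade_involution_def\<close>)
  finally show ?thesis .
qed

lemma alt_wedge_unit_left:
  fixes \<beta> :: "('a, 'b::finite) alt"
  shows "alt_wedge alt_unit \<beta> = \<beta>"
proof
  fix vs show "alt_wedge alt_unit \<beta> vs = \<beta> vs"
  proof (induction vs arbitrary: \<beta>)
    case (Cons w vs)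
    have "contraction w alt_unit = (\<lambda>us. 0)"
      "grade_involution alt_unit = (alt_unit :: ('a, 'b) alt)"
      by (auto simp: contraction_def alt_unit_def grade_involution_def fun_eq_iff)
    then have "alt_wedge alt_unit \<beta> (w # vs) = contraction w \<beta> vs"
      by (simp add: alt_wedge_Cons Cons.IH)
    then show ?case by (simp add: contraction_def)
  qed (simp add: alt_unit_def)
qed

lemma alt_wedge_unit_right: "alt_wedge \<alpha> alt_unit = \<alpha>"
proof
  fix vs show "alt_wedge \<alpha> alt_unit vs = \<alpha> vs"
  proof (induction vs arbitrary: \<alpha>)
    case (Cons w vs)
    have "contraction w alt_unit = (\<lambda>us. 0)"
      by (auto simp: contraction_def alt_unit_def fun_eq_iff)
    then show ?case by (simp add: alt_wedge_Cons Cons.IH) (simp add: contraction_def)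
  qed (simp add: alt_unit_def)
qed

lemma alt_wedge_degree_0:
  assumes "\<And>us. us \<noteq> [] \<Longrightarrow> \<alpha> us = 0"
  shows "alt_wedge \<alpha> \<beta> = (\<lambda>vs. \<alpha> [] * \<beta> vs)"
proof -
  have "\<alpha> = (\<lambda>us. \<alpha> [] * alt_unit us)"
    using assms by (auto simp: alt_unit_def fun_eq_iff)
  then show ?thesis by (metis alt_wedge_scale_left alt_wedge_unit_left)
qed

lemma contraction_grade_involution:
  "contraction v (grade_involution \<alpha>) = (\<lambda>us. - grade_involution (contraction v \<alpha>) us)"
  by (simp add: contraction_def grade_involution_def)

locale tangent_vectors =
  fixes T :: "('a, 'n::finite) tvec set"
  assumes comb: "v \<in> T \<Longrightarrow> w \<in> T \<Longrightarrow> (\<lambda>c. a *\<^sub>R v c + b *\<^sub>R w c) \<in> T"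
begin

lemma adjacent_swap:
  assumes lin: "\<And>us ws v w a b. v \<in> T \<Longrightarrow> w \<in> T \<Longrightarrow>
      \<alpha> (us @ (\<lambda>c. a *\<^sub>R v c + b *\<^sub>R w c) # ws) = a * \<alpha> (us @ v # ws) + b * \<alpha> (us @ w # ws)"
    and adj: "\<And>us ws v. \<alpha> (us @ v # v # ws) = 0"
    and out: "\<And>vs. \<not> set vs \<subseteq> T \<Longrightarrow> \<alpha> vs = 0"
  shows "\<alpha> (us @ v # w # ws) = - \<alpha> (us @ w # v # ws)"
proof (cases "v \<in> T \<and> w \<in> T")
  case True
  let ?s = "\<lambda>c. 1 *\<^sub>R v c + 1 *\<^sub>R w c"
  have s: "?s \<in> T" using True comb by blast
  have "0 = \<alpha> (us @ ?s # ?s # ws)" by (rule adj[symmetric])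
  also have "\<dots> = \<alpha> (us @ v # ?s # ws) + \<alpha> (us @ w # ?s # ws)"
    using lin[of v w us 1 1 "?s # ws"] True by simp
  also have "\<dots> = \<alpha> (us @ v # w # ws) + \<alpha> (us @ w # v # ws)"
    using lin[of v w "us @ [v]" 1 1 ws] lin[of v w "us @ [w]" 1 1 ws] True adj by simp
  finally show ?thesis by simp
next
  case False
  then have "\<not> set (us @ v # w # ws) \<subseteq> T" "\<not> set (us @ w # v # ws) \<subseteq> T" by auto
  then show ?thesis using out by simp
qed

text \<open>It suffices to test equal neighbours: by \<open>adjacent_swap\<close>, equal arguments that are further apart
  can be moved next to each other.\<close>

lemma alternating_formsI_adjacent:
  assumes lin: "\<And>us ws v w a b. v \<in> T \<Longrightarrow> w \<in> T \<Longrightarrow>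
      \<alpha> (us @ (\<lambda>c. a *\<^sub>R v c + b *\<^sub>R w c) # ws) = a * \<alpha> (us @ v # ws) + b * \<alpha> (us @ w # ws)"
    and adj: "\<And>us ws v. \<alpha> (us @ v # v # ws) = 0"
    and out: "\<And>vs. \<not> set vs \<subseteq> T \<Longrightarrow> \<alpha> vs = 0"
  shows "\<alpha> \<in> alternating_forms T"
proof (rule alternating_formsI[OF lin _ out])
  show "\<alpha> (us @ v # vs @ v # ws) = 0" for us vs ws v
  proof (induction vs arbitrary: us)
    case Nil
    then show ?case by (simp add: adj)
  next
    case (Cons w vs)
    have "\<alpha> (us @ v # w # vs @ v # ws) = - \<alpha> ((us @ [w]) @ v # vs @ v # ws)"
      by (rule trans[OF adjacent_swap[where \<alpha> = \<alpha>, OF lin adj out]]) simp_all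
    then show ?case by (simp only: Cons.IH append_Cons)
  qed
qed

lemma alternating_swap:
  assumes "\<alpha> \<in> alternating_forms T"
  shows "\<alpha> (us @ v # w # ws) = - \<alpha> (us @ w # v # ws)"
proof (rule adjacent_swap[where \<alpha> = \<alpha>])
  show "\<alpha> (us @ v # v # ws) = 0" for us v ws
    using alternating_repeated[OF assms, of us v "[]" ws] by simp
qed (fact alternating_linear[OF assms], fact alternating_outside[OF assms])

lemma alternating_move:
  assumes "\<alpha> \<in> alternating_forms T"
  shows "\<alpha> (us @ w # vs) = (-1) ^ length us * \<alpha> (w # us @ vs)"
proof (induction us arbitrary: vs rule: rev_induct)
  case (snoc u us)
  have "\<alpha> ((us @ [u]) @ w # vs) = - \<alpha> (us @ w # u # vs)"
    using alternating_swap[OF assms, of us u w vs] by simp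
  then show ?case using snoc[of "u # vs"] by simp
qed simp

lemma contraction_anticommute:
  "\<alpha> \<in> alternating_forms T \<Longrightarrow> contraction v (contraction w \<alpha>) = (\<lambda>us. (-1) * contraction w (contraction v \<alpha>) us)"
  using alternating_swap[of \<alpha> "[]" w v] unfolding contraction_def by (intro ext) simp

text \<open>Peeling off arguments with \<open>alt_wedge_Cons\<close> reduces each of the three properties to the first
  arguments. For two equal first arguments \<open>v\<close>, the terms in which \<open>\<alpha>\<close> and \<open>\<beta>\<close> receive one \<open>v\<close>
  each occur twice, with opposite signs.\<close>

lemma alternating_wedge:
  assumes "\<alpha> \<in> alternating_forms T" "\<beta> \<in> alternating_forms T"
  shows "alt_wedge \<alpha> \<beta> \<in> alternating_forms T"
proof (rule alternating_formsI_adjacent)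
  have closed: "contraction w \<gamma> \<in> alternating_forms T" "grade_involution \<gamma> \<in> alternating_forms T"
    if "\<gamma> \<in> alternating_forms T" for w and \<gamma> :: "('a, 'n) alt"
    using that by (auto simp: grade_involution_def alternating_contraction
        intro: alternating_graded_scale)
  show "alt_wedge \<alpha> \<beta> (us @ (\<lambda>c. a *\<^sub>R v c + b *\<^sub>R w c) # ws) =
      a * alt_wedge \<alpha> \<beta> (us @ v # ws) + b * alt_wedge \<alpha> \<beta> (us @ w # ws)"
    if vw: "v \<in> T" "w \<in> T" for us ws v w a b
    using assms
  proof (induction us arbitrary: \<alpha> \<beta>)
    case Nil
    have "contraction (\<lambda>c. a *\<^sub>R v c + b *\<^sub>R w c) \<gamma> =
        (\<lambda>us. a * contraction v \<gamma> us + b * contraction w \<gamma> us)" if "\<gamma> \<in> alternating_forms T" for \<gamma>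
      using alternating_linear[OF that vw, of "[]"] by (simp add: contraction_def fun_eq_iff)
    then show ?case
      using Nil by (simp add: alt_wedge_Cons alt_wedge_add_left alt_wedge_add_right
          alt_wedge_scale_left alt_wedge_scale_right algebra_simps)
  next
    case (Cons u us)
    then show ?case by (simp add: alt_wedge_Cons closed algebra_simps)
  qed
  show "alt_wedge \<alpha> \<beta> (us @ v # v # ws) = 0" for us ws v
    using assms
  proof (induction us arbitrary: \<alpha> \<beta>)
    case Nil
    have "contraction v (contraction v \<gamma>) = (\<lambda>us. 0)" if "\<gamma> \<in> alternating_forms T" for \<gamma>
      using alternating_repeated[OF that, of "[]" v "[]"] by (simp add: contraction_def fun_eq_iff)
    then show ?case
      using Nil
      by (simp add: alt_wedge_Cons contraction_grade_involution alt_wedge_minus_left)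
  next
    case (Cons u us)
    then show ?case by (simp add: alt_wedge_Cons closed)
  qed
  show "alt_wedge \<alpha> \<beta> vs = 0" if "\<not> set vs \<subseteq> T" for vs
    using assms that
  proof (induction vs arbitrary: \<alpha> \<beta>)
    case (Cons w vs)
    show ?case
    proof (cases "w \<in> T")
      case True
      then show ?thesis using Cons by (simp add: alt_wedge_Cons closed)
    next
      case False
      then have "contraction w \<gamma> = (\<lambda>us. 0)" if "\<gamma> \<in> alternating_forms T" for \<gamma>
        using alternating_outside[OF that] by (auto simp: contraction_def fun_eq_iff)
      then show ?thesis using Cons.prems by (simp add: alt_wedge_Cons)
    qed
  qed simp
qed

lemma zero_vector: "v \<in> T \<Longrightarrow> (\<lambda>c. 0) \<in> T"
  using comb[of v v 0 0] by simp

lemma sum_vectors: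
  assumes "T \<noteq> {}" "\<And>i. i \<in> I \<Longrightarrow> v i \<in> T"
  shows "(\<lambda>c. \<Sum>i\<in>I. a i *\<^sub>R v i c) \<in> T"
  using assms(2)
proof (induction I rule: infinite_finite_induct)
  case (insert i I)
  then show ?case using comb[of "v i" _ "a i" 1] by simp
qed (use assms(1) zero_vector in auto)

lemma alternating_linear_sum:
  assumes "\<alpha> \<in> alternating_forms T" "T \<noteq> {}" "\<And>i. i \<in> I \<Longrightarrow> v i \<in> T"
  shows "\<alpha> (us @ (\<lambda>c. \<Sum>i\<in>I. a i *\<^sub>R v i c) # ws) = (\<Sum>i\<in>I. a i * \<alpha> (us @ v i # ws))"
proof -
  obtain t where t: "t \<in> T" using assms(2) by blast
  have zero: "\<alpha> (us @ (\<lambda>c. 0) # ws) = 0"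
    using alternating_linear[OF assms(1) t t, of us 0 0 ws] by simp
  show ?thesis
    using assms(3)
  proof (induction I rule: infinite_finite_induct)
    case (insert i I)
    then show ?case
      using alternating_linear[OF assms(1) insert.prems[of i] sum_vectors[of I v a], of us "a i" 1 ws]
        assms(2) by simp
  qed (auto simp: zero)
qed

end

section \<open>The Hodge operator at a point\<close>

text \<open>The full contraction of the \<open>r\<close>-form part of \<open>\<alpha>\<close> against \<open>\<gamma>\<close>:
  \<open>\<Sum> \<epsilon>\<^bsub>i\<^sub>1\<^esub> \<dots> \<epsilon>\<^bsub>i\<^sub>r\<^esub> \<alpha>(E\<^bsub>i\<^sub>1\<^esub>, \<dots>, E\<^bsub>i\<^sub>r\<^esub>) \<gamma>(E\<^bsub>i\<^sub>1\<^esub>, \<dots>, E\<^bsub>i\<^sub>r\<^esub>, _)\<close>. The recursion mirrors that of the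
  contracted wedge product.\<close>

primrec pairing ::
  "nat \<Rightarrow> (nat \<Rightarrow> real) \<Rightarrow> (nat \<Rightarrow> ('a, 'n::finite) tvec) \<Rightarrow> nat \<Rightarrow>
   ('a, 'n) alt \<Rightarrow> ('a, 'n) alt \<Rightarrow> ('a, 'n) alt" where
  "pairing n \<epsilon> E 0 \<alpha> \<gamma> = (\<lambda>vs. \<alpha> [] * \<gamma> vs)"
| "pairing n \<epsilon> E (Suc r) \<alpha> \<gamma> =
     (\<lambda>vs. \<Sum>i=1..n. \<epsilon> i * pairing n \<epsilon> E r (contraction (E i) \<alpha>) (contraction (E i) \<gamma>) vs)"

text \<open>The coefficient of the term with \<open>l = r\<close> in the Graf product of an \<open>r\<close>-form with a form of
  degree at least \<open>r\<close>.\<close>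

definition hodge_coeff :: "nat \<Rightarrow> real" where
  "hodge_coeff r = (-1) ^ (r div 2) / fact r"

definition alt_hodge ::
  "nat \<Rightarrow> (nat \<Rightarrow> real) \<Rightarrow> (nat \<Rightarrow> ('a, 'n::finite) tvec) \<Rightarrow> ('a, 'n) alt \<Rightarrow>
   ('a, 'n) alt \<Rightarrow> ('a, 'n) alt" where
  "alt_hodge n \<epsilon> E \<nu> \<alpha> = (\<lambda>vs. \<Sum>r\<le>n. hodge_coeff r * pairing n \<epsilon> E r \<alpha> \<nu> vs)"

lemma sign_half_Suc: "(-1::real) ^ (Suc r div 2) = (-1) ^ r * (-1) ^ (r div 2)"
proof (cases "even r")
  case True
  then show ?thesis by simp
next
  case False
  then show ?thesis by (simp add: odd_Suc_div_two)
qed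

text \<open>This recursion is the only property of the coefficients that the relations between \<open>\<star>\<close>, wedge
  products and contractions depend on.\<close>

lemma hodge_coeff_Suc: "hodge_coeff (Suc r) * real (Suc r) = (-1) ^ r * hodge_coeff r"
  by (simp add: hodge_coeff_def sign_half_Suc field_simps del: of_nat_Suc)

lemma pairing_scale_left:
  "pairing n \<epsilon> E r (\<lambda>us. k * \<alpha> us) \<gamma> vs = k * pairing n \<epsilon> E r \<alpha> \<gamma> vs"
  by (induction r arbitrary: \<alpha> \<gamma>) (simp_all add: contraction_def sum_distrib_left mult_ac)

lemma pairing_add_left:
  "pairing n \<epsilon> E r (\<lambda>us. \<alpha> us + \<alpha>' us) \<gamma> vs = pairing n \<epsilon> E r \<alpha> \<gamma> vs + pairing n \<epsilon> E r \<alpha>' \<gamma> vs"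
  by (induction r arbitrary: \<alpha> \<alpha>' \<gamma>) (simp_all add: contraction_def sum.distrib algebra_simps)

lemma pairing_scale_right:
  "pairing n \<epsilon> E r \<alpha> (\<lambda>us. k * \<gamma> us) vs = k * pairing n \<epsilon> E r \<alpha> \<gamma> vs"
  by (induction r arbitrary: \<alpha> \<gamma>) (simp_all add: contraction_def sum_distrib_left mult_ac)

lemma pairing_add_right:
  "pairing n \<epsilon> E r \<alpha> (\<lambda>us. \<gamma> us + \<gamma>' us) vs = pairing n \<epsilon> E r \<alpha> \<gamma> vs + pairing n \<epsilon> E r \<alpha> \<gamma>' vs"
  by (induction r arbitrary: \<alpha> \<gamma> \<gamma>') (simp_all add: contraction_def sum.distrib algebra_simps)

lemma pairing_zero_left:
  "(\<And>us. length us = r \<Longrightarrow> \<alpha> us = 0) \<Longrightarrow> pairing n \<epsilon> E r \<alpha> \<gamma> vs = 0"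
  by (induction r arbitrary: \<alpha> \<gamma>) (simp_all add: contraction_def)

lemma pairing_zero_right:
  "(\<And>us. length us \<ge> r \<Longrightarrow> \<gamma> us = 0) \<Longrightarrow> pairing n \<epsilon> E r \<alpha> \<gamma> vs = 0"
  by (induction r arbitrary: \<alpha> \<gamma>) (simp_all add: contraction_def)

lemma pairing_cong_left:
  "(\<And>us. length us = r \<Longrightarrow> \<alpha> us = \<alpha>' us) \<Longrightarrow> pairing n \<epsilon> E r \<alpha> \<gamma> vs = pairing n \<epsilon> E r \<alpha>' \<gamma> vs"
proof (induction r arbitrary: \<alpha> \<alpha>' \<gamma>)
  case (Suc r)
  have "pairing n \<epsilon> E r (contraction (E i) \<alpha>) (contraction (E i) \<gamma>) vs =
      pairing n \<epsilon> E r (contraction (E i) \<alpha>') (contraction (E i) \<gamma>) vs" for i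
    by (rule Suc.IH) (simp add: contraction_def Suc.prems)
  then show ?case by simp
qed simp

lemma pairing_alternating:
  "\<gamma> \<in> alternating_forms T \<Longrightarrow> pairing n \<epsilon> E r \<alpha> \<gamma> \<in> alternating_forms T"
  by (induction r arbitrary: \<alpha> \<gamma>)
    (auto intro!: alternating_sum alternating_scale alternating_contraction)

text \<open>A frame with dual coframe, in which the metric is diagonal with entries \<open>\<epsilon> i\<close>.\<close>

locale weighted_frame = tangent_vectors T
  for T :: "('a, 'n::finite) tvec set" +
  fixes n :: nat and \<epsilon> :: "nat \<Rightarrow> real"
    and E :: "nat \<Rightarrow> ('a, 'n) tvec" and \<theta> :: "nat \<Rightarrow> ('a, 'n) alt"
  assumes frame: "i \<in> {1..n} \<Longrightarrow> E i \<in> T"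
    and coframe: "i \<in> {1..n} \<Longrightarrow> \<theta> i \<in> alternating_forms T"
    and coframe_degree: "i \<in> {1..n} \<Longrightarrow> length vs \<noteq> 1 \<Longrightarrow> \<theta> i vs = 0"
    and dual: "i \<in> {1..n} \<Longrightarrow> j \<in> {1..n} \<Longrightarrow> \<theta> i [E j] = (if i = j then 1 else 0)"
    and spanning: "w \<in> T \<Longrightarrow> w = (\<lambda>c. \<Sum>i=1..n. \<theta> i [w] *\<^sub>R E i c)"
    and nonempty: "T \<noteq> {}"
begin

definition ext :: "nat \<Rightarrow> ('a, 'n) alt \<Rightarrow> ('a, 'n) alt" where
  "ext j \<alpha> = alt_wedge (\<theta> j) \<alpha>"

abbreviation \<iota> :: "nat \<Rightarrow> ('a, 'n) alt \<Rightarrow> ('a, 'n) alt" where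
  "\<iota> i \<equiv> contraction (E i)"

abbreviation pair :: "nat \<Rightarrow> ('a, 'n) alt \<Rightarrow> ('a, 'n) alt \<Rightarrow> ('a, 'n) alt" where
  "pair \<equiv> pairing n \<epsilon> E"

lemma ext_Nil: "j \<in> {1..n} \<Longrightarrow> ext j \<alpha> [] = 0"
  by (simp add: ext_def coframe_degree)

text \<open>The antiderivation rule for a factor of degree one, where contracting the factor gives a
  scalar.\<close>

lemma ext_Cons:
  assumes "j \<in> {1..n}"
  shows "ext j \<alpha> (w # vs) = \<theta> j [w] * \<alpha> vs - ext j (contraction w \<alpha>) vs"
proof -
  have "grade_involution (\<theta> j) = (\<lambda>us. - \<theta> j us)"
  proof
    fix us show "grade_involution (\<theta> j) us = - \<theta> j us"
      using coframe_degree[OF assms, of us] by (cases "length us = 1") (simp_all add: grade_involution_def)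
  qed
  moreover have "alt_wedge (contraction w (\<theta> j)) \<alpha> = (\<lambda>vs. contraction w (\<theta> j) [] * \<alpha> vs)"
    using coframe_degree[OF assms] by (intro alt_wedge_degree_0) (simp add: contraction_def)
  ultimately show ?thesis
    unfolding ext_def alt_wedge_Cons by (simp add: contraction_def alt_wedge_minus_left)
qed

lemma contraction_ext:
  assumes "i \<in> {1..n}" "j \<in> {1..n}"
  shows "\<iota> i (ext j \<alpha>) = (\<lambda>vs. (if i = j then 1 else 0) * \<alpha> vs + (-1) * ext j (\<iota> i \<alpha>) vs)"
proof
  fix vs
  have "\<iota> i (ext j \<alpha>) vs = ext j \<alpha> (E i # vs)" by (simp add: contraction_def)
  then show "\<iota> i (ext j \<alpha>) vs = (if i = j then 1 else 0) * \<alpha> vs + (-1) * ext j (\<iota> i \<alpha>) vs"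
    using assms by (simp add: ext_Cons dual)
qed

lemma ext_scale: "ext j (\<lambda>us. k * \<alpha> us) = (\<lambda>vs. k * ext j \<alpha> vs)"
  by (simp add: ext_def alt_wedge_scale_right)

lemma ext_sum: "ext j (\<lambda>us. \<Sum>i\<in>I. \<alpha> i us) = (\<lambda>vs. \<Sum>i\<in>I. ext j (\<alpha> i) vs)"
  by (simp add: ext_def alt_wedge_sum_right)

lemma alternating_ext:
  "j \<in> {1..n} \<Longrightarrow> \<alpha> \<in> alternating_forms T \<Longrightarrow> ext j \<alpha> \<in> alternating_forms T"
  unfolding ext_def by (intro alternating_wedge coframe)

lemma alternating_spanning:
  assumes "\<alpha> \<in> alternating_forms T" "w \<in> T"
  shows "\<alpha> (us @ w # vs) = (\<Sum>i=1..n. \<theta> i [w] * \<alpha> (us @ E i # vs))"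
  by (subst spanning[OF assms(2)]) (rule alternating_linear_sum[OF assms(1) nonempty frame])

text \<open>Expanding all arguments in the frame leaves lists of more than \<open>n\<close> frame vectors, in which one
  vector occurs twice. The induction replaces the arguments by frame vectors one at a time.\<close>

lemma alternating_vanishes:
  assumes \<alpha>: "\<alpha> \<in> alternating_forms T" and long: "length vs > n"
  shows "\<alpha> vs = 0"
proof -
  have "\<alpha> (map E is @ vs) = 0" if "set is \<subseteq> {1..n}" "length is + length vs > n" for "is" vs
    using that
  proof (induction vs arbitrary: "is")
    case Nil
    have "\<not> distinct is"
    proof
      assume "distinct is"
      then have "length is = card (set is)" by (simp add: distinct_card)
      also have "\<dots> \<le> n" using card_mono[OF _ Nil.prems(1)] by simp
      finally show False using Nil.prems(2) by simp
    qed
    then obtain xs ys zs y where "is = xs @ [y] @ ys @ [y] @ zs"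
      using not_distinct_decomp by blast
    then show ?case using alternating_repeated[OF \<alpha>] by simp
  next
    case (Cons w vs)
    show ?case
    proof (cases "w \<in> T")
      case True
      have "\<alpha> (map E is @ E i # vs) = 0" if "i \<in> {1..n}" for i
        using Cons.IH[of "is @ [i]"] Cons.prems that by simp
      then show ?thesis by (simp add: alternating_spanning[OF \<alpha> True])
    next
      case False
      then show ?thesis by (intro alternating_outside[OF \<alpha>]) simp
    qed
  qed
  from this[of "[]" vs] long show ?thesis by simp
qed

text \<open>Euler's identity. The first argument \<open>w\<close> is either taken by one of the \<open>\<theta>\<^sup>i\<close>, which reproduces
  \<open>\<alpha>\<close> once because \<open>w = \<Sum>\<^sub>i \<theta>\<^sup>i(w) E\<^sub>i\<close>, or it goes to \<open>\<alpha>\<close>, where the induction hypothesis for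
  \<open>\<iota>\<^sub>w \<alpha>\<close> counts the remaining arguments; the two signs from moving \<open>w\<close> past \<open>\<theta>\<^sup>i\<close> and \<open>\<iota>\<^sub>i\<close>
  cancel.\<close>

lemma euler_identity:
  assumes "\<alpha> \<in> alternating_forms T"
  shows "(\<Sum>i=1..n. ext i (\<iota> i \<alpha>) vs) = real (length vs) * \<alpha> vs"
  using assms
proof (induction vs arbitrary: \<alpha>)
  case Nil
  then show ?case by (simp add: ext_Nil)
next
  case (Cons w vs)
  show ?case
  proof (cases "w \<in> T")
    case True
    have "(\<Sum>i=1..n. ext i (\<iota> i \<alpha>) (w # vs)) =
        (\<Sum>i=1..n. \<theta> i [w] * \<alpha> (E i # vs)) - (\<Sum>i=1..n. ext i (contraction w (\<iota> i \<alpha>)) vs)"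
      by (simp add: ext_Cons contraction_def sum_subtractf)
    also have "(\<Sum>i=1..n. \<theta> i [w] * \<alpha> (E i # vs)) = \<alpha> (w # vs)"
      using alternating_spanning[OF Cons.prems True, of "[]"] by simp
    also have "(\<Sum>i=1..n. ext i (contraction w (\<iota> i \<alpha>)) vs) =
        - (\<Sum>i=1..n. ext i (\<iota> i (contraction w \<alpha>)) vs)"
      by (simp only: contraction_anticommute[OF Cons.prems, of w] ext_scale)
        (simp add: sum_negf)
    also have "(\<Sum>i=1..n. ext i (\<iota> i (contraction w \<alpha>)) vs) = real (length vs) * contraction w \<alpha> vs"
      by (rule Cons.IH[OF alternating_contraction[OF Cons.prems]])
    finally show ?thesis by (simp add: contraction_def algebra_simps)
  next
    case False
    then have "\<not> set (w # vs) \<subseteq> T" by simp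
    then have "\<alpha> (w # vs) = 0" "ext i (\<iota> i \<alpha>) (w # vs) = 0" if "i \<in> {1..n}" for i
      using alternating_outside Cons.prems alternating_ext alternating_contraction that by blast+
    moreover have "\<alpha> (w # vs) = 0" using alternating_outside[OF Cons.prems] False by simp
    ultimately show ?thesis by simp
  qed
qed

lemma sum_delta_frame:
  "j \<in> {1..n} \<Longrightarrow> (\<Sum>i=1..n. (if i = j then 1 else 0) * k i) = (k j :: real)"
  by (simp add: if_distrib[where f = "\<lambda>x. x * _"] sum.delta cong: if_cong)

text \<open>In the full contraction \<open>\<theta>\<^sup>j\<close> can absorb any of the \<open>r + 1\<close> frame vectors, and since \<open>\<gamma>\<close> is
  alternating, all these choices contribute equally. In the induction the first summed vector is
  either the one absorbed or belongs to \<open>\<alpha>\<close>.\<close>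

lemma pair_ext_left:
  assumes "j \<in> {1..n}" "\<gamma> \<in> alternating_forms T"
  shows "pair (Suc r) (ext j \<alpha>) \<gamma> vs = real (Suc r) * \<epsilon> j * pair r \<alpha> (\<iota> j \<gamma>) vs"
  using assms(2)
proof (induction r arbitrary: \<alpha> \<gamma>)
  case 0
  have "pair (Suc 0) (ext j \<alpha>) \<gamma> vs =
      (\<Sum>i=1..n. (if i = j then 1 else 0) * (\<epsilon> i * \<alpha> [] * \<iota> i \<gamma> vs))"
    using assms(1) by (auto simp: contraction_ext ext_Nil mult_ac intro!: sum.cong)
  then show ?case using assms(1) by (simp only: sum_delta_frame) simp
next
  case (Suc r)
  have step: "pair (Suc r) (\<iota> i (ext j \<alpha>)) (\<iota> i \<gamma>) vs =
      (if i = j then 1 else 0) * pair (Suc r) \<alpha> (\<iota> i \<gamma>) vs +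
      real (Suc r) * \<epsilon> j * pair r (\<iota> i \<alpha>) (\<iota> i (\<iota> j \<gamma>)) vs" if "i \<in> {1..n}" for i
  proof -
    have "pair (Suc r) (\<iota> i (ext j \<alpha>)) (\<iota> i \<gamma>) vs =
        (if i = j then 1 else 0) * pair (Suc r) \<alpha> (\<iota> i \<gamma>) vs +
        (-1) * pair (Suc r) (ext j (\<iota> i \<alpha>)) (\<iota> i \<gamma>) vs"
      by (simp only: contraction_ext[OF that assms(1)] pairing_add_left pairing_scale_left)
    also have "pair (Suc r) (ext j (\<iota> i \<alpha>)) (\<iota> i \<gamma>) vs =
        real (Suc r) * \<epsilon> j * pair r (\<iota> i \<alpha>) (\<iota> j (\<iota> i \<gamma>)) vs"
      by (rule Suc.IH[OF alternating_contraction[OF Suc.prems]])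
    also have "\<iota> j (\<iota> i \<gamma>) = (\<lambda>us. (-1) * \<iota> i (\<iota> j \<gamma>) us)"
      by (rule contraction_anticommute[OF Suc.prems])
    finally show ?thesis by (simp only: pairing_scale_right)
  qed
  have "pair (Suc (Suc r)) (ext j \<alpha>) \<gamma> vs =
      (\<Sum>i=1..n. \<epsilon> i * pair (Suc r) (\<iota> i (ext j \<alpha>)) (\<iota> i \<gamma>) vs)"
    by (simp only: pairing.simps)
  also have "\<dots> = (\<Sum>i=1..n. (if i = j then 1 else 0) * (\<epsilon> i * pair (Suc r) \<alpha> (\<iota> i \<gamma>) vs) +
      real (Suc r) * \<epsilon> j * (\<epsilon> i * pair r (\<iota> i \<alpha>) (\<iota> i (\<iota> j \<gamma>)) vs))"
    by (rule sum.cong) (simp_all only: step distrib_left mult_ac)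
  also have "\<dots> = \<epsilon> j * pair (Suc r) \<alpha> (\<iota> j \<gamma>) vs +
      real (Suc r) * \<epsilon> j * pair (Suc r) \<alpha> (\<iota> j \<gamma>) vs"
    unfolding sum.distrib sum_delta_frame[OF assms(1)] sum_distrib_left[symmetric] by simp
  finally show ?case by (simp add: algebra_simps del: pairing.simps)
qed

lemma contraction_pair:
  assumes "\<gamma> \<in> alternating_forms T"
  shows "\<iota> j (pair r \<alpha> \<gamma>) vs = (-1) ^ r * pair r \<alpha> (\<iota> j \<gamma>) vs"
  using assms
proof (induction r arbitrary: \<alpha> \<gamma>)
  case 0
  then show ?case by (simp add: contraction_def)
next
  case (Suc r)
  have "\<iota> j (pair (Suc r) \<alpha> \<gamma>) vs = (\<Sum>i=1..n. \<epsilon> i * \<iota> j (pair r (\<iota> i \<alpha>) (\<iota> i \<gamma>)) vs)"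
    by (simp add: contraction_def)
  also have "\<dots> = (\<Sum>i=1..n. \<epsilon> i * ((-1) ^ r * pair r (\<iota> i \<alpha>) (\<iota> j (\<iota> i \<gamma>)) vs))"
    using Suc.IH[OF alternating_contraction[OF Suc.prems]] by simp
  also have "\<dots> = (\<Sum>i=1..n. (-1) ^ Suc r * (\<epsilon> i * pair r (\<iota> i \<alpha>) (\<iota> i (\<iota> j \<gamma>)) vs))"
  proof (rule sum.cong[OF refl])
    fix i
    have "\<iota> j (\<iota> i \<gamma>) = (\<lambda>us. (-1) * \<iota> i (\<iota> j \<gamma>) us)"
      by (rule contraction_anticommute[OF Suc.prems])
    then show "\<epsilon> i * ((-1) ^ r * pair r (\<iota> i \<alpha>) (\<iota> j (\<iota> i \<gamma>)) vs) =
        (-1) ^ Suc r * (\<epsilon> i * pair r (\<iota> i \<alpha>) (\<iota> i (\<iota> j \<gamma>)) vs)"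
      by (simp only: pairing_scale_right) simp
  qed
  finally show ?case by (simp add: sum_distrib_left)
qed

text \<open>Multiplication by \<open>\<theta>\<^sup>j\<close> is moved past the \<open>r\<close> contractions of \<open>\<gamma>\<close>. Each of them anticommutes
  with it, up to the term where \<open>\<theta>\<^sup>j\<close> meets its dual vector, which turns that contraction of
  \<open>\<alpha>\<close> into \<open>\<iota>\<^sub>j\<close>.\<close>

lemma ext_pair:
  assumes "j \<in> {1..n}" "\<alpha> \<in> alternating_forms T"
  shows "ext j (pair r \<alpha> \<gamma>) vs =
    (-1) ^ r * (pair r \<alpha> (ext j \<gamma>) vs - r * \<epsilon> j * pair (r - 1) (\<iota> j \<alpha>) \<gamma> vs)"
  using assms(2)
proof (induction r arbitrary: \<alpha> \<gamma>)
  case 0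
  then show ?case by (simp add: ext_scale)
next
  case (Suc r)
  have step: "ext j (pair r (\<iota> i \<alpha>) (\<iota> i \<gamma>)) vs =
      (-1) ^ r * ((if i = j then 1 else 0) * pair r (\<iota> i \<alpha>) \<gamma> vs
        - pair r (\<iota> i \<alpha>) (\<iota> i (ext j \<gamma>)) vs
        + r * \<epsilon> j * pair (r - 1) (\<iota> i (\<iota> j \<alpha>)) (\<iota> i \<gamma>) vs)" if "i \<in> {1..n}" for i
  proof -
    have "\<iota> i (ext j \<gamma>) = (\<lambda>us. (if i = j then 1 else 0) * \<gamma> us + (-1) * ext j (\<iota> i \<gamma>) us)"
      by (rule contraction_ext[OF that assms(1)])
    then have 1: "pair r (\<iota> i \<alpha>) (\<iota> i (ext j \<gamma>)) vs =
        (if i = j then 1 else 0) * pair r (\<iota> i \<alpha>) \<gamma> vs + (-1) * pair r (\<iota> i \<alpha>) (ext j (\<iota> i \<gamma>)) vs"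
      by (simp only: pairing_add_right pairing_scale_right)
    have "\<iota> j (\<iota> i \<alpha>) = (\<lambda>us. (-1) * \<iota> i (\<iota> j \<alpha>) us)"
      by (rule contraction_anticommute[OF Suc.prems])
    then have 2: "pair (r - 1) (\<iota> j (\<iota> i \<alpha>)) (\<iota> i \<gamma>) vs =
        (-1) * pair (r - 1) (\<iota> i (\<iota> j \<alpha>)) (\<iota> i \<gamma>) vs"
      by (simp only: pairing_scale_left)
    show ?thesis
      unfolding Suc.IH[OF alternating_contraction[OF Suc.prems]] 2
      using 1 by simp
  qed
  have lower: "(\<Sum>i=1..n. \<epsilon> i * (r * \<epsilon> j * pair (r - 1) (\<iota> i (\<iota> j \<alpha>)) (\<iota> i \<gamma>) vs)) =
      r * \<epsilon> j * pair r (\<iota> j \<alpha>) \<gamma> vs"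
    by (cases r) (simp_all add: sum_distrib_left mult_ac)
  have "ext j (pair (Suc r) \<alpha> \<gamma>) vs = (\<Sum>i=1..n. \<epsilon> i * ext j (pair r (\<iota> i \<alpha>) (\<iota> i \<gamma>)) vs)"
    by (simp add: ext_sum ext_scale)
  also have "\<dots> = (\<Sum>i=1..n. (-1) ^ r * ((if i = j then 1 else 0) * (\<epsilon> i * pair r (\<iota> i \<alpha>) \<gamma> vs)
        - \<epsilon> i * pair r (\<iota> i \<alpha>) (\<iota> i (ext j \<gamma>)) vs
        + \<epsilon> i * (r * \<epsilon> j * pair (r - 1) (\<iota> i (\<iota> j \<alpha>)) (\<iota> i \<gamma>) vs)))"
    by (rule sum.cong) (simp_all only: step, simp add: algebra_simps)
  also have "\<dots> = (-1) ^ r * (\<epsilon> j * pair r (\<iota> j \<alpha>) \<gamma> vs - pair (Suc r) \<alpha> (ext j \<gamma>) vs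
      + r * \<epsilon> j * pair r (\<iota> j \<alpha>) \<gamma> vs)"
    unfolding sum_distrib_left[symmetric] sum.distrib sum_subtractf sum_delta_frame[OF assms(1)] lower
    by simp
  finally show ?case by (simp add: algebra_simps del: pairing.simps)
qed

lemma ext_degree:
  assumes "j \<in> {1..n}" "\<And>us. length us \<noteq> r \<Longrightarrow> \<alpha> us = 0" "length vs \<noteq> Suc r"
  shows "ext j \<alpha> vs = 0"
  using assms(2,3)
proof (induction vs arbitrary: \<alpha> r)
  case Nil
  show ?case by (rule ext_Nil[OF assms(1)])
next
  case (Cons w vs)
  have "ext j (contraction w \<alpha>) vs = 0"
  proof (cases r)
    case 0
    then have "contraction w \<alpha> = (\<lambda>us. 0)" using Cons.prems(1) by (auto simp: contraction_def)
    then show ?thesis by (simp add: ext_def)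
  next
    case (Suc r')
    then show ?thesis
      by (intro Cons.IH[of r']) (use Cons.prems in \<open>auto simp: contraction_def\<close>)
  qed
  then show ?case using Cons.prems by (simp add: ext_Cons[OF assms(1)])
qed

abbreviation monomial :: "nat list \<Rightarrow> ('a, 'n) alt" where
  "monomial is \<equiv> foldr ext is alt_unit"

lemma monomial_alternating: "set is \<subseteq> {1..n} \<Longrightarrow> monomial is \<in> alternating_forms T"
  by (induction "is") (auto intro: alternating_unit alternating_ext)

lemma monomial_degree: "set is \<subseteq> {1..n} \<Longrightarrow> length vs \<noteq> length is \<Longrightarrow> monomial is vs = 0"
proof (induction "is" arbitrary: vs)
  case Nil
  then show ?case by (simp add: alt_unit_def)
next
  case (Cons i "is")
  then show ?case by (auto intro: ext_degree[where r = "length is"])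
qed

lemma contraction_monomial:
  "set is \<subseteq> {1..n} \<Longrightarrow> a \<in> {1..n} \<Longrightarrow> a \<notin> set is \<Longrightarrow> \<iota> a (monomial is) = (\<lambda>us. 0)"
proof (induction "is")
  case Nil
  then show ?case by (simp add: contraction_def alt_unit_def)
next
  case (Cons i "is")
  then show ?case by (simp add: contraction_ext) (simp add: ext_def)
qed

lemma monomial_frame:
  "set is \<subseteq> {1..n} \<Longrightarrow> distinct is \<Longrightarrow> monomial is (map E is) = 1"
proof (induction "is")
  case Nil
  then show ?case by (simp add: alt_unit_def)
next
  case (Cons i "is")
  then show ?case
    by (simp add: ext_Cons contraction_monomial dual) (simp add: ext_def)
qed

definition volume :: "('a, 'n) alt" where
  "volume = monomial [1..<Suc n]"

abbreviation hodge :: "('a, 'n) alt \<Rightarrow> ('a, 'n) alt" where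
  "hodge \<equiv> alt_hodge n \<epsilon> E volume"

lemma volume_alternating: "volume \<in> alternating_forms T"
  unfolding volume_def by (rule monomial_alternating) auto

lemma volume_degree: "length vs \<noteq> n \<Longrightarrow> volume vs = 0"
  unfolding volume_def by (rule monomial_degree) (auto simp del: upt_Suc)

lemma ext_volume: "j \<in> {1..n} \<Longrightarrow> ext j volume = (\<lambda>us. 0)"
proof
  fix us assume j: "j \<in> {1..n}"
  show "ext j volume us = 0"
  proof (cases "length us = Suc n")
    case True
    then show ?thesis
      by (intro alternating_vanishes[OF alternating_ext[OF j volume_alternating]]) simp
  next
    case False
    then show ?thesis by (intro ext_degree[OF j volume_degree])
  qed
qed

lemma hodge_alternating: "hodge \<alpha> \<in> alternating_forms T"
  unfolding alt_hodge_def
  by (intro alternating_sum alternating_scale pairing_alternating volume_alternating)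

lemma hodge_add: "hodge (\<lambda>us. \<alpha> us + \<beta> us) = (\<lambda>vs. hodge \<alpha> vs + hodge \<beta> vs)"
  by (simp add: alt_hodge_def pairing_add_left sum.distrib algebra_simps)

lemma hodge_scale: "hodge (\<lambda>us. k * \<alpha> us) = (\<lambda>vs. k * hodge \<alpha> vs)"
  by (simp add: alt_hodge_def pairing_scale_left sum_distrib_left mult_ac)

lemma hodge_zero: "hodge (\<lambda>us. 0) = (\<lambda>vs. 0)"
  using hodge_scale[of 0 "\<lambda>us. 0"] by simp

lemma hodge_sum: "hodge (\<lambda>us. \<Sum>i\<in>I. \<alpha> i us) = (\<lambda>vs. \<Sum>i\<in>I. hodge (\<alpha> i) vs)"
  by (induction I rule: infinite_finite_induct) (simp_all add: hodge_zero hodge_add)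

text \<open>Termwise this is \<open>pair_ext_left\<close>: the factor \<open>r + 1\<close> cancels against the factorials and the sign
  \<open>(-1)\<^sup>r\<close> in \<open>hodge_coeff_Suc\<close> is that of moving \<open>\<iota>\<^sub>j\<close> out of the contraction with \<open>\<nu>\<close>.\<close>

lemma hodge_ext:
  assumes j: "j \<in> {1..n}"
  shows "hodge (ext j \<alpha>) = (\<lambda>vs. \<epsilon> j * \<iota> j (hodge \<alpha>) vs)"
proof
  fix vs
  \<comment> \<open>The sum for \<open>\<theta>\<^sup>j \<and> \<alpha>\<close> reaches degree \<open>n - 1\<close> of \<open>\<alpha>\<close> only.\<close>
  have top: "pair n \<alpha> (\<iota> j volume) vs = 0"
    by (rule pairing_zero_right) (simp add: contraction_def volume_degree)
  have "hodge (ext j \<alpha>) vs =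
      (\<Sum>r<n. hodge_coeff (Suc r) * (real (Suc r) * \<epsilon> j * pair r \<alpha> (\<iota> j volume) vs))"
    unfolding alt_hodge_def sum.atMost_shift pair_ext_left[OF j volume_alternating]
    by (simp add: ext_Nil[OF j])
  also have "\<dots> = (\<Sum>r<n. (hodge_coeff (Suc r) * real (Suc r)) * (\<epsilon> j * pair r \<alpha> (\<iota> j volume) vs))"
    by (simp only: mult_ac)
  also have "\<dots> = \<epsilon> j * (\<Sum>r<n. hodge_coeff r * ((-1) ^ r * pair r \<alpha> (\<iota> j volume) vs))"
    unfolding hodge_coeff_Suc sum_distrib_left by (simp only: mult_ac)
  also have "\<dots> = \<epsilon> j * (\<Sum>r\<le>n. hodge_coeff r * ((-1) ^ r * pair r \<alpha> (\<iota> j volume) vs))"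
    unfolding lessThan_Suc_atMost[symmetric] by (simp add: top)
  also have "\<dots> = \<epsilon> j * (\<Sum>r\<le>n. hodge_coeff r * \<iota> j (pair r \<alpha> volume) vs)"
    by (simp only: contraction_pair[OF volume_alternating])
  finally show "hodge (ext j \<alpha>) vs = \<epsilon> j * \<iota> j (hodge \<alpha>) vs"
    by (simp add: alt_hodge_def contraction_def)
qed

text \<open>Here the volume element enters through \<open>\<theta>\<^sup>j \<and> \<nu> = 0\<close>, so that in \<open>ext_pair\<close> only the term with
  \<open>\<iota>\<^sub>j \<alpha>\<close> is left.\<close>

lemma ext_hodge:
  assumes j: "j \<in> {1..n}" and \<alpha>: "\<alpha> \<in> alternating_forms T"
  shows "ext j (hodge \<alpha>) = (\<lambda>vs. \<epsilon> j * hodge (\<iota> j \<alpha>) vs)"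
proof
  fix vs
  \<comment> \<open>It would need a component of \<open>\<alpha>\<close> of degree \<open>n + 1\<close>.\<close>
  have top: "pair n (\<iota> j \<alpha>) volume vs = 0"
    by (rule pairing_zero_left) (simp add: contraction_def alternating_vanishes[OF \<alpha>])
  have "ext j (hodge \<alpha>) vs = (\<Sum>r\<le>n. hodge_coeff r * ext j (pair r \<alpha> volume) vs)"
    unfolding alt_hodge_def by (simp add: ext_sum ext_scale)
  also have "\<dots> = (\<Sum>r\<le>n. hodge_coeff r * ((-1) ^ r * (- (r * \<epsilon> j * pair (r - 1) (\<iota> j \<alpha>) volume vs))))"
    by (simp only: ext_pair[OF j \<alpha>] ext_volume[OF j]) (simp add: pairing_zero_right)
  also have "\<dots> = (\<Sum>r<n. (hodge_coeff (Suc r) * real (Suc r)) * ((-1) ^ r * (\<epsilon> j * pair r (\<iota> j \<alpha>) volume vs)))"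
    unfolding sum.atMost_shift by (simp add: mult_ac)
  also have "\<dots> = (\<Sum>r<n. \<epsilon> j * (hodge_coeff r * pair r (\<iota> j \<alpha>) volume vs))"
  proof (rule sum.cong[OF refl])
    fix r
    have "(-1::real) ^ r * (-1) ^ r = 1" by (simp flip: power_mult_distrib)
    then show "(hodge_coeff (Suc r) * real (Suc r)) * ((-1) ^ r * (\<epsilon> j * pair r (\<iota> j \<alpha>) volume vs)) =
        \<epsilon> j * (hodge_coeff r * pair r (\<iota> j \<alpha>) volume vs)"
      unfolding hodge_coeff_Suc by (simp add: algebra_simps)
  qed
  also have "\<dots> = \<epsilon> j * (\<Sum>r\<le>n. hodge_coeff r * pair r (\<iota> j \<alpha>) volume vs)"
    unfolding lessThan_Suc_atMost[symmetric] by (simp add: top sum_distrib_left)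
  finally show "ext j (hodge \<alpha>) vs = \<epsilon> j * hodge (\<iota> j \<alpha>) vs"
    by (simp add: alt_hodge_def)
qed

lemma hodge_hodge_ext:
  assumes "j \<in> {1..n}"
  shows "hodge (hodge (ext j \<alpha>)) = ext j (hodge (hodge \<alpha>))"
  by (simp only: hodge_ext[OF assms] hodge_scale ext_hodge[OF assms hodge_alternating])

lemma hodge_unit: "hodge alt_unit = volume"
proof
  fix vs
  have "pair r alt_unit volume vs = 0" if "r > 0" for r
    by (rule pairing_zero_left) (use that in \<open>auto simp: alt_unit_def\<close>)
  then have "hodge alt_unit vs = (\<Sum>r\<in>{0}. hodge_coeff r * pair r alt_unit volume vs)"
    unfolding alt_hodge_def by (intro sum.mono_neutral_right) auto
  then show "hodge alt_unit vs = volume vs" by (simp add: hodge_coeff_def alt_unit_def)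
qed

text \<open>Each factor of the monomial contracts the volume element once, and the first factor contracts
  last. This is the source of the reversal.\<close>

lemma hodge_monomial:
  "set is \<subseteq> {1..n} \<Longrightarrow>
   hodge (monomial is) = (\<lambda>vs. (\<Prod>i\<leftarrow>is. \<epsilon> i) * volume (map E (rev is) @ vs))"
proof (induction "is")
  case Nil
  then show ?case by (simp only: foldr.simps hodge_unit id_apply) simp
next
  case (Cons i "is")
  then have "hodge (monomial (i # is)) = (\<lambda>vs. \<epsilon> i * \<iota> i (hodge (monomial is)) vs)"
    using hodge_ext[of i "monomial is"] by simp
  also have "hodge (monomial is) = (\<lambda>vs. (\<Prod>i\<leftarrow>is. \<epsilon> i) * volume (map E (rev is) @ vs))"
    using Cons by simp
  finally show ?case by (simp add: contraction_def mult_ac)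
qed

text \<open>The reversal of \<open>k\<close> arguments has sign \<open>(-1)\<^sup>k\<^sup>(\<^sup>k\<^sup>-\<^sup>1\<^sup>)\<^sup>/\<^sup>2 = (-1)\<^sup>[\<^sup>k\<^sup>/\<^sup>2\<^sup>]\<close>; both sides satisfy the
  recursion \<open>sign_half_Suc\<close>.\<close>

lemma alternating_rev:
  assumes "\<alpha> \<in> alternating_forms T"
  shows "\<alpha> (rev us @ vs) = (-1) ^ (length us div 2) * \<alpha> (us @ vs)"
proof (induction us arbitrary: vs)
  case (Cons u us)
  then show ?case
    using alternating_move[OF assms, of us u vs]
    by (simp add: sign_half_Suc del: power_Suc)
qed simp

text \<open>The square of the volume element in the Clifford algebra.\<close>

lemma hodge_volume:
  "hodge volume = (\<lambda>vs. (\<Prod>i=1..n. \<epsilon> i) * (-1) ^ (n div 2) * alt_unit vs)"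
proof
  fix vs
  let ?is = "[1..<Suc n]"
  have eq: "hodge volume vs = (\<Prod>i\<leftarrow>?is. \<epsilon> i) * volume (map E (rev ?is) @ vs)"
    by (subst (2) volume_def, subst hodge_monomial) (auto simp del: upt_Suc)
  have prod: "(\<Prod>i\<leftarrow>?is. \<epsilon> i) = (\<Prod>i=1..n. \<epsilon> i)"
    using prod.distinct_set_conv_list[of ?is \<epsilon>]
    by (simp add: atLeastLessThanSuc_atLeastAtMost del: upt_Suc)
  show "hodge volume vs = (\<Prod>i=1..n. \<epsilon> i) * (-1) ^ (n div 2) * alt_unit vs"
  proof (cases "vs = []")
    case True
    have "volume (rev (map E ?is) @ []) = (-1) ^ (n div 2) * volume (map E ?is @ [])"
      using alternating_rev[OF volume_alternating, of "map E ?is" "[]"]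
      by (simp del: upt_Suc)
    moreover have "volume (map E ?is) = 1"
      unfolding volume_def by (rule monomial_frame) (auto simp del: upt_Suc)
    ultimately show ?thesis using True eq prod by (simp add: alt_unit_def rev_map del: upt_Suc)
  next
    case False
    then have "length (map E (rev ?is) @ vs) \<noteq> n" by (simp del: upt_Suc)
    then show ?thesis using eq False by (simp add: volume_degree alt_unit_def del: upt_Suc)
  qed
qed

text \<open>The operators \<open>\<theta>\<^sup>i \<and> _\<close> commute with \<open>\<star>\<star>\<close> and generate the algebra from the unit. The
  induction bounds the degrees occurring in \<open>\<alpha>\<close>.\<close>

lemma hodge_involution:
  assumes sign: "(\<Prod>i=1..n. \<epsilon> i) * (-1) ^ (n div 2) = 1"
    and \<alpha>: "\<alpha> \<in> alternating_forms T"
  shows "hodge (hodge \<alpha>) = \<alpha>"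
proof -
  have unit: "hodge (hodge (\<lambda>us. a * alt_unit us)) = (\<lambda>us. a * alt_unit us)" for a
    by (simp only: hodge_scale hodge_unit hodge_volume sign) simp
  have "hodge (hodge \<alpha>) = \<alpha>" if "\<And>us. length us > k \<Longrightarrow> \<alpha> us = 0" for k
    using \<alpha> that
  proof (induction k arbitrary: \<alpha>)
    case 0
    then have "\<alpha> = (\<lambda>us. \<alpha> [] * alt_unit us)" by (auto simp: alt_unit_def)
    then show ?case by (metis unit)
  next
    case (Suc k)
    \<comment> \<open>Dividing each component of \<open>\<alpha>\<close> by its degree turns Euler's identity into a decomposition of
      \<open>\<alpha>\<close> whose contracted parts have smaller degree. In degree 0 the inverse is \<open>0\<close>, which leaves
      the scalar component to the first summand.\<close>
    define \<beta> where "\<beta> us = inverse (real (length us)) * \<alpha> us" for us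
    have \<beta>: "\<beta> \<in> alternating_forms T"
      unfolding \<beta>_def by (rule alternating_graded_scale[OF Suc.prems(1)])
    have fixed: "hodge (hodge (\<iota> i \<beta>)) = \<iota> i \<beta>" for i
      by (rule Suc.IH[OF alternating_contraction[OF \<beta>]])
        (simp add: contraction_def \<beta>_def Suc.prems(2))
    have decomposition: "\<alpha> = (\<lambda>us. \<alpha> [] * alt_unit us + (\<Sum>i=1..n. ext i (\<iota> i \<beta>) us))"
      unfolding euler_identity[OF \<beta>] by (auto simp: alt_unit_def \<beta>_def fun_eq_iff)
    have "hodge (hodge \<alpha>) = (\<lambda>us. \<alpha> [] * alt_unit us + (\<Sum>i=1..n. ext i (\<iota> i \<beta>) us))"
      by (subst decomposition, simp only: hodge_add hodge_sum unit)
        (simp only: hodge_hodge_ext fixed cong: sum.cong)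
    then show ?case using decomposition by simp
  qed
  from this[of n] show ?thesis using alternating_vanishes[OF \<alpha>] by blast
qed

end

section \<open>The Graf product with the volume form\<close>

lemma length_nths_complement: "length (nths vs S) + length (nths vs (- S)) = length vs"
proof -
  have "card {i. i < length vs \<and> i \<in> S} + card {i. i < length vs \<and> i \<in> - S} =
      card ({i. i < length vs \<and> i \<in> S} \<union> {i. i < length vs \<and> i \<in> - S})"
    by (rule card_Un_disjoint[symmetric]) auto
  also have "{i. i < length vs \<and> i \<in> S} \<union> {i. i < length vs \<and> i \<in> - S} = {..<length vs}"
    by auto
  finally show ?thesis by (simp add: length_nths)
qed

primrec alt_contracted_wedge ::
  "nat \<Rightarrow> (nat \<Rightarrow> real) \<Rightarrow> (nat \<Rightarrow> ('a, 'n::finite) tvec) \<Rightarrow> nat \<Rightarrow>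
   ('a, 'n) alt \<Rightarrow> ('a, 'n) alt \<Rightarrow> ('a, 'n) alt" where
  "alt_contracted_wedge n \<epsilon> E 0 \<alpha> \<beta> = alt_wedge \<alpha> \<beta>"
| "alt_contracted_wedge n \<epsilon> E (Suc l) \<alpha> \<beta> = (\<lambda>vs. \<Sum>i=1..n.
     \<epsilon> i * alt_contracted_wedge n \<epsilon> E l (contraction (E i) \<alpha>) (contraction (E i) \<beta>) vs)"

lemma alt_contracted_wedge_scale_right:
  "alt_contracted_wedge n \<epsilon> E l \<alpha> (\<lambda>us. k * \<beta> us) vs = k * alt_contracted_wedge n \<epsilon> E l \<alpha> \<beta> vs"
  by (induction l arbitrary: \<alpha> \<beta>)
    (simp_all add: contraction_def alt_wedge_scale_right sum_distrib_left mult_ac)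

lemma alt_contracted_wedge_top:
  assumes "\<And>us. length us \<noteq> r \<Longrightarrow> \<alpha> us = 0"
  shows "alt_contracted_wedge n \<epsilon> E r \<alpha> \<beta> vs = pairing n \<epsilon> E r \<alpha> \<beta> vs"
  using assms
proof (induction r arbitrary: \<alpha> \<beta>)
  case 0
  then show ?case by (simp add: alt_wedge_degree_0)
next
  case (Suc r)
  have "alt_contracted_wedge n \<epsilon> E r (contraction (E i) \<alpha>) (contraction (E i) \<beta>) vs =
      pairing n \<epsilon> E r (contraction (E i) \<alpha>) (contraction (E i) \<beta>) vs" for i
    by (rule Suc.IH) (simp add: contraction_def Suc.prems)
  then show ?case by simp
qed

context weighted_frame
begin

definition multi_contraction :: "nat list \<Rightarrow> ('a, 'n) alt \<Rightarrow> ('a, 'n) alt" where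
  "multi_contraction is \<alpha> = (\<lambda>vs. \<alpha> (map E is @ vs))"

lemma multi_contraction_alternating:
  "\<alpha> \<in> alternating_forms T \<Longrightarrow> multi_contraction is \<alpha> \<in> alternating_forms T"
proof (induction "is" arbitrary: \<alpha>)
  case Nil
  then show ?case by (simp add: multi_contraction_def)
next
  case (Cons i "is")
  from Cons.IH[OF alternating_contraction[OF Cons.prems, of "E i"]]
  show ?case by (simp add: multi_contraction_def contraction_def)
qed

lemma wedge_volume:
  assumes "\<beta> \<in> alternating_forms T" "\<And>us. length us \<noteq> r \<Longrightarrow> \<beta> us = 0" "r > 0"
  shows "alt_wedge \<beta> volume vs = 0"
proof (cases "length vs > n")
  case True
  then show ?thesis
    by (rule alternating_vanishes[OF alternating_wedge[OF assms(1) volume_alternating]])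
next
  case False
  have "\<beta> (nths vs S) * volume (nths vs (- S)) = 0" for S
  proof (cases "length (nths vs S) = r")
    case True
    then have "length (nths vs (- S)) \<noteq> n"
      using length_nths_complement[of vs S] False assms(3) by linarith
    then show ?thesis by (simp add: volume_degree)
  qed (simp add: assms(2))
  then show ?thesis unfolding alt_wedge_def by (auto intro!: sum.neutral)
qed

text \<open>Since \<open>\<beta>\<close> is annihilated by the contractions, contracting \<open>\<beta> \<and> \<gamma> = 0\<close> gives
  \<open>\<plusminus> \<beta> \<and> \<iota>\<^sub>i \<gamma> = 0\<close>, and this can be repeated.\<close>

lemma wedge_multi_contraction:
  assumes "\<And>us. length us \<noteq> r \<Longrightarrow> \<beta> us = 0" "\<And>i. i \<in> set is \<Longrightarrow> \<iota> i \<beta> = (\<lambda>us. 0)"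
    and "alt_wedge \<beta> \<gamma> = (\<lambda>us. 0)"
  shows "alt_wedge \<beta> (multi_contraction is \<gamma>) = (\<lambda>us. 0)"
  using assms(2,3)
proof (induction "is" arbitrary: \<gamma>)
  case Nil
  then show ?case by (simp add: multi_contraction_def)
next
  case (Cons i "is")
  have involution: "grade_involution \<beta> = (\<lambda>us. (-1) ^ r * \<beta> us)"
  proof
    show "grade_involution \<beta> us = (-1) ^ r * \<beta> us" for us
      using assms(1)[of us] by (cases "length us = r") (auto simp: grade_involution_def)
  qed
  have "alt_wedge \<beta> (\<iota> i \<gamma>) us = 0" for us
    using alt_wedge_Cons[of \<beta> \<gamma> "E i" us] Cons.prems
    by (simp add: involution alt_wedge_scale_left)
  then have "alt_wedge \<beta> (multi_contraction is (\<iota> i \<gamma>)) = (\<lambda>us. 0)"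
    using Cons.prems(1) by (intro Cons.IH) auto
  then show ?case by (simp add: multi_contraction_def contraction_def)
qed

text \<open>Each summand of this contracted wedge product is \<open>\<beta> \<and> \<iota>\<^sub>I \<nu>\<close> with \<open>\<beta> = \<iota>\<^sub>I \<alpha>\<close> of positive degree.
  As \<open>\<alpha>\<close> is alternating, \<open>\<beta>\<close> is annihilated by the contractions in \<open>I\<close>, so the summand vanishes
  together with \<open>\<beta> \<and> \<nu>\<close>, whose degree exceeds \<open>n\<close>. The induction accumulates \<open>I\<close>.\<close>

lemma contracted_wedge_volume_low:
  assumes \<alpha>: "\<alpha> \<in> alternating_forms T" "\<And>us. length us \<noteq> r \<Longrightarrow> \<alpha> us = 0" and "l < r"
  shows "alt_contracted_wedge n \<epsilon> E l \<alpha> volume vs = 0"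
proof -
  have "alt_contracted_wedge n \<epsilon> E l (multi_contraction is \<alpha>) (multi_contraction is volume) vs = 0"
    if "length is + l < r" for "is"
    using that
  proof (induction l arbitrary: "is")
    case 0
    let ?\<beta> = "multi_contraction is \<alpha>"
    have degree: "?\<beta> us = 0" if "length us \<noteq> r - length is" for us
      unfolding multi_contraction_def by (rule \<alpha>(2)) (use that 0 in auto)
    have "\<iota> i ?\<beta> = (\<lambda>us. 0)" if i: "i \<in> set is" for i
    proof -
      obtain xs ys where "is = xs @ i # ys" using i by (meson split_list)
      then show ?thesis
        using alternating_repeated[OF \<alpha>(1), of "map E xs" "E i" "map E ys"]
        by (simp add: contraction_def multi_contraction_def)
    qed
    moreover have "alt_wedge ?\<beta> volume = (\<lambda>us. 0)"
      using wedge_volume[OF multi_contraction_alternating[OF \<alpha>(1)] degree] 0 by auto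
    ultimately have "alt_wedge ?\<beta> (multi_contraction is volume) = (\<lambda>us. 0)"
      by (intro wedge_multi_contraction[where r = "r - length is"] degree)
    then show ?case by simp
  next
    case (Suc l)
    have "\<iota> i (multi_contraction is \<gamma>) = multi_contraction (is @ [i]) \<gamma>" for i \<gamma>
      by (simp add: contraction_def multi_contraction_def)
    then show ?case using Suc.IH[of "is @ [_]"] Suc.prems by simp
  qed
  from this[of "[]"] assms(3) show ?thesis by (simp add: multi_contraction_def)
qed

lemma graf_sum_volume:
  assumes "\<alpha> \<in> alternating_forms T" "\<And>us. length us \<noteq> r \<Longrightarrow> \<alpha> us = 0"
  shows "(\<Sum>l=0..r. (-1) ^ (l * (r - l) + l div 2) / fact l *
            alt_contracted_wedge n \<epsilon> E l \<alpha> volume vs) = hodge_coeff r * pair r \<alpha> volume vs"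
proof -
  have "(\<Sum>l=0..r. (-1) ^ (l * (r - l) + l div 2) / fact l *
            alt_contracted_wedge n \<epsilon> E l \<alpha> volume vs) =
        (\<Sum>l\<in>{r}. (-1) ^ (l * (r - l) + l div 2) / fact l *
            alt_contracted_wedge n \<epsilon> E l \<alpha> volume vs)"
    by (rule sum.mono_neutral_right)
      (auto simp: contracted_wedge_volume_low[OF assms])
  then show ?thesis by (simp add: alt_contracted_wedge_top[OF assms(2)] hodge_coeff_def)
qed

end

section \<open>The dual frame\<close>

locale local_orthonormal_coframe =
  fixes M :: "'a topology" and A :: "('a, 'n::finite) chart set" and g :: "('a, 'n) metric"
    and p q :: nat and U :: "'a set" and e :: "nat \<Rightarrow> ('a, 'n) form"
  assumes manifold: "smooth_manifold M A"
    and metric: "pseudo_riemannian_metric M A g p q"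
    and open_U: "openin M U"
    and orthonormal: "orthonormal_coframe A g p U e"
begin

abbreviation sign :: "nat \<Rightarrow> real" where "sign i \<equiv> sign_matrix p i i"

abbreviation frame_at :: "'a \<Rightarrow> nat \<Rightarrow> ('a, 'n) tvec" where
  "frame_at x i \<equiv> dual_frame A e i x"

lemma tangent_vectors_at: "tangent_vectors (tangent_space A x)"
  by unfold_locales (rule tangent_space_comb[OF manifold])

lemma sign_square: "sign i * sign i = 1"
  by (simp add: sign_matrix_def)

context
  fixes x assumes x: "x \<in> U"
begin

interpretation tangent_vectors "tangent_space A x" by (rule tangent_vectors_at)

lemma in_M: "x \<in> topspace M"
  using x open_U openin_subset by blast

lemma metric_sym:
  "u \<in> tangent_space A x \<Longrightarrow> v \<in> tangent_space A x \<Longrightarrow> g x u v = g x v u"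
  using metric in_M unfolding pseudo_riemannian_metric_def by blast

lemma metric_linear:
  "u \<in> tangent_space A x \<Longrightarrow> v \<in> tangent_space A x \<Longrightarrow> w \<in> tangent_space A x \<Longrightarrow>
   g x (\<lambda>c. a *\<^sub>R u c + b *\<^sub>R v c) w = a * g x u w + b * g x v w"
  using metric in_M unfolding pseudo_riemannian_metric_def by blast

lemma metric_nondegenerate:
  "u \<in> tangent_space A x \<Longrightarrow> (\<And>v. v \<in> tangent_space A x \<Longrightarrow> g x u v = 0) \<Longrightarrow> u = (\<lambda>c. 0)"
  using metric in_M unfolding pseudo_riemannian_metric_def by blast

lemma metric_basis:
  "\<exists>b. is_basis (tangent_space A x) (p + q) b \<and>
       (\<forall>i\<in>{1..p+q}. \<forall>j\<in>{1..p+q}. g x (b i) (b j) = sign_matrix p i j)"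
  using metric in_M unfolding pseudo_riemannian_metric_def by blast

text \<open>Nonemptiness lets \<open>alternating_linear_sum\<close> and its analogue for the metric handle empty
  sums: the zero vector is a combination of tangent vectors only if there are any.\<close>

lemma tangent_nonempty: "tangent_space A x \<noteq> {}"
proof -
  obtain c where "c \<in> A" "x \<in> fst c"
    using manifold in_M unfolding smooth_manifold_def smooth_atlas_def by blast
  then show ?thesis using coord_vec_tangent[OF manifold] by blast
qed

lemma metric_linear_sum:
  assumes "\<And>i. i \<in> I \<Longrightarrow> v i \<in> tangent_space A x" "w \<in> tangent_space A x"
  shows "g x (\<lambda>c. \<Sum>i\<in>I. a i *\<^sub>R v i c) w = (\<Sum>i\<in>I. a i * g x (v i) w)"
proof -
  have zero: "g x (\<lambda>c. 0) w = 0"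
    using metric_linear[OF assms(2) assms(2) assms(2), of 0 0] by simp
  show ?thesis
    using assms(1)
  proof (induction I rule: infinite_finite_induct)
    case (insert i I)
    then have "(\<lambda>c. \<Sum>i\<in>I. a i *\<^sub>R v i c) \<in> tangent_space A x"
      using sum_vectors[OF tangent_nonempty] by blast
    then show ?case
      using metric_linear[of "v i" "\<lambda>c. \<Sum>i\<in>I. a i *\<^sub>R v i c" w "a i" 1] insert assms(2) by simp
  qed (simp_all add: zero)
qed

definition lower :: "('a, 'n) tvec \<Rightarrow> ('a, 'n) alt" where
  "lower v vs = (if length vs = 1 \<and> set vs \<subseteq> tangent_space A x then g x v (hd vs) else 0)"

lemma lower_cotangent:
  assumes "v \<in> tangent_space A x"
  shows "lower v \<in> cotangent_space A x"
proof -
  have "lower v (us @ (\<lambda>c. a *\<^sub>R u c + b *\<^sub>R w c) # ws) = a * lower v (us @ u # ws) + b * lower v (us @ w # ws)"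
    if "u \<in> tangent_space A x" "w \<in> tangent_space A x" for us ws u w a b
  proof (cases "us = [] \<and> ws = []")
    case True
    then show ?thesis
      using that comb[OF that] metric_sym[OF _ assms] metric_linear[OF that assms]
      by (simp add: lower_def metric_sym[OF assms])
  qed (auto simp: lower_def)
  then have "lower v \<in> alternating_forms (tangent_space A x)"
    by (rule alternating_formsI) (auto simp: lower_def)
  then show ?thesis by (simp add: cotangent_space_def ext_cotangent_eq lower_def)
qed

lemma lower_apply: "w \<in> tangent_space A x \<Longrightarrow> lower v [w] = g x v w"
  by (simp add: lower_def)

text \<open>The representing vector is \<open>\<Sum>\<^sub>i \<epsilon>\<^sub>i \<alpha>(b\<^sub>i) b\<^sub>i\<close> for an orthonormal basis \<open>b\<close>.\<close>

lemma sharp_exists: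
  assumes "\<alpha> \<in> cotangent_space A x"
  shows "\<exists>v\<in>tangent_space A x. \<forall>w\<in>tangent_space A x. g x v w = \<alpha> [w]"
proof -
  obtain b where b: "is_basis (tangent_space A x) (p + q) b"
    and gb: "\<And>i j. i \<in> {1..p+q} \<Longrightarrow> j \<in> {1..p+q} \<Longrightarrow> g x (b i) (b j) = sign_matrix p i j"
    using metric_basis by blast
  have \<alpha>: "\<alpha> \<in> alternating_forms (tangent_space A x)"
    using assms by (simp add: cotangent_space_def ext_cotangent_eq)
  have bT: "b i \<in> tangent_space A x" if "i \<in> {1..p+q}" for i
    using b that by (auto simp: is_basis_def)
  define v where "v = (\<lambda>c. \<Sum>i=1..p+q. (sign i * \<alpha> [b i]) *\<^sub>R b i c)"
  have v: "v \<in> tangent_space A x"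
    unfolding v_def by (intro sum_vectors tangent_nonempty bT)
  have "g x v w = \<alpha> [w]" if w: "w \<in> tangent_space A x" for w
  proof -
    obtain k where k: "w = (\<lambda>c. \<Sum>i=1..p+q. k i *\<^sub>R b i c)"
      using b w unfolding is_basis_def by blast
    have "g x (b i) w = k i * sign i" if i: "i \<in> {1..p+q}" for i
    proof -
      have "g x (b i) w = g x w (b i)" using metric_sym bT[OF i] w by blast
      also have "\<dots> = (\<Sum>j=1..p+q. k j * g x (b j) (b i))"
        unfolding k by (rule metric_linear_sum[OF bT bT[OF i]])
      also have "\<dots> = (\<Sum>j=1..p+q. if j = i then k i * sign i else 0)"
        by (rule sum.cong[OF refl]) (use gb i in \<open>auto simp: sign_matrix_def\<close>)
      finally show ?thesis using i by simp
    qed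
    moreover have "g x v w = (\<Sum>i=1..p+q. (sign i * \<alpha> [b i]) * g x (b i) w)"
      unfolding v_def by (rule metric_linear_sum[OF bT w])
    ultimately have "g x v w = (\<Sum>i=1..p+q. k i * \<alpha> [b i])"
      using sign_square by (simp add: mult_ac) (simp add: mult.assoc[symmetric])
    also have "\<dots> = \<alpha> [w]"
      using alternating_linear_sum[OF \<alpha> tangent_nonempty, of "{1..p+q}" b "[]" k "[]"] bT
      by (simp add: k)
    finally show ?thesis .
  qed
  with v show ?thesis by blast
qed

lemma metric_separating:
  assumes "v \<in> tangent_space A x" "w \<in> tangent_space A x"
    "\<And>u. u \<in> tangent_space A x \<Longrightarrow> g x u v = g x u w"
  shows "v = w"
proof -
  let ?d = "\<lambda>c. 1 *\<^sub>R v c + (-1) *\<^sub>R w c"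
  have "g x ?d u = 0" if "u \<in> tangent_space A x" for u
    using metric_linear[OF assms(1,2) that, of 1 "-1"] assms(3)[OF that]
      metric_sym[OF that assms(1)] metric_sym[OF that assms(2)] by simp
  then have "?d = (\<lambda>c. 0)" by (intro metric_nondegenerate comb assms)
  then show ?thesis by (simp add: fun_eq_iff)
qed

lemma sharp_properties:
  assumes "\<alpha> \<in> cotangent_space A x"
  shows "sharp A g x \<alpha> \<in> tangent_space A x"
    "w \<in> tangent_space A x \<Longrightarrow> g x (sharp A g x \<alpha>) w = \<alpha> [w]"
proof -
  have "\<exists>!v. v \<in> tangent_space A x \<and> (\<forall>w\<in>tangent_space A x. g x v w = \<alpha> [w])"
    using sharp_exists[OF assms] metric_separating metric_sym by (smt (verit))
  from theI'[OF this] show "sharp A g x \<alpha> \<in> tangent_space A x"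
    "w \<in> tangent_space A x \<Longrightarrow> g x (sharp A g x \<alpha>) w = \<alpha> [w]"
    unfolding sharp_def by blast+
qed

lemma coframe_cotangent: "i \<in> {1..CARD('n)} \<Longrightarrow> e i x \<in> cotangent_space A x"
  using orthonormal x unfolding orthonormal_coframe_def coframe_def is_basis_def by blast

text \<open>The coframe spans all covectors, in particular the metric duals of tangent vectors, and these
  separate points because the metric is nondegenerate.\<close>

lemma coframe_separating:
  assumes "v \<in> tangent_space A x" "w \<in> tangent_space A x"
    "\<And>i. i \<in> {1..CARD('n)} \<Longrightarrow> e i x [v] = e i x [w]"
  shows "v = w"
proof (rule metric_separating[OF assms(1,2)])
  fix u assume u: "u \<in> tangent_space A x"
  have "is_basis (cotangent_space A x) CARD('n) (\<lambda>i. e i x)"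
    using orthonormal x unfolding orthonormal_coframe_def coframe_def by blast
  then obtain k where k: "lower u = (\<lambda>vs. \<Sum>i=1..CARD('n). k i *\<^sub>R e i x vs)"
    using lower_cotangent[OF u] unfolding is_basis_def by blast
  have "lower u [v] = lower u [w]" unfolding k using assms(3) by simp
  then show "g x u v = g x u w" using assms by (simp add: lower_apply)
qed

text \<open>By orthonormality \<open>e\<^sup>i(e\<^sup>j\<^sup>\<sharp>) = g\<^sup>*(e\<^sup>i, e\<^sup>j) = \<epsilon>\<^sub>j \<delta>\<^sub>i\<^sub>j\<close>, so \<open>\<epsilon>\<^sub>j e\<^sup>j\<^sup>\<sharp>\<close> is the dual vector.\<close>

lemma dual_frame_properties:
  assumes "j \<in> {1..CARD('n)}"
  shows "frame_at x j \<in> tangent_space A x"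
    "i \<in> {1..CARD('n)} \<Longrightarrow> e i x [frame_at x j] = (if i = j then 1 else 0)"
proof -
  let ?s = "sharp A g x (e j x)"
  \<comment> \<open>The zero summand gives the scalar multiple the shape in which linearity is stated.\<close>
  define v where "v = (\<lambda>c. sign j *\<^sub>R ?s c + 0 *\<^sub>R ?s c)"
  have s: "?s \<in> tangent_space A x" by (rule sharp_properties(1)[OF coframe_cotangent[OF assms]])
  have v: "v \<in> tangent_space A x" unfolding v_def by (intro comb s)
  have "e i x [v] = (if i = j then 1 else 0)" if i: "i \<in> {1..CARD('n)}" for i
  proof -
    have "e i x \<in> alternating_forms (tangent_space A x)"
      using coframe_cotangent[OF i] by (simp add: cotangent_space_def ext_cotangent_eq)
    from alternating_linear[OF this s s, of "[]" "sign j" 0 "[]"]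
    have "e i x [v] = sign j * e i x [?s]" by (simp add: v_def)
    also have "e i x [?s] = g x (sharp A g x (e i x)) ?s"
      using sharp_properties(2)[OF coframe_cotangent[OF i] s] by simp
    also have "\<dots> = sign_matrix p i j"
      using orthonormal x i assms unfolding orthonormal_coframe_def dual_metric_def by blast
    finally show ?thesis using sign_square[of j] by (auto simp: sign_matrix_def)
  qed
  then have "\<exists>!v. v \<in> tangent_space A x \<and> (\<forall>i\<in>{1..CARD('n)}. e i x [v] = (if i = j then 1 else 0))"
    using v coframe_separating by (intro ex1I[of _ v]) auto
  from theI'[OF this] show "frame_at x j \<in> tangent_space A x"
    "i \<in> {1..CARD('n)} \<Longrightarrow> e i x [frame_at x j] = (if i = j then 1 else 0)"
    unfolding dual_frame_def by blast+
qed

end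

lemma weighted_frame_at:
  assumes x: "x \<in> U"
  shows "weighted_frame (tangent_space A x) CARD('n) (frame_at x) (\<lambda>i. e i x)"
proof -
  interpret tangent_vectors "tangent_space A x" by (rule tangent_vectors_at)
  have alt: "e i x \<in> alternating_forms (tangent_space A x)" if "i \<in> {1..CARD('n)}" for i
    using coframe_cotangent[OF x that] by (simp add: cotangent_space_def ext_cotangent_eq)
  have span: "w = (\<lambda>c. \<Sum>i=1..CARD('n). e i x [w] *\<^sub>R frame_at x i c)" if w: "w \<in> tangent_space A x" for w
  proof (rule coframe_separating[OF x w])
    show "(\<lambda>c. \<Sum>i=1..CARD('n). e i x [w] *\<^sub>R frame_at x i c) \<in> tangent_space A x"
      by (intro sum_vectors tangent_nonempty[OF x] dual_frame_properties[OF x])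
    show "e j x [w] = e j x [\<lambda>c. \<Sum>i=1..CARD('n). e i x [w] *\<^sub>R frame_at x i c]" if j: "j \<in> {1..CARD('n)}" for j
    proof -
      have "e j x ([] @ (\<lambda>c. \<Sum>i=1..CARD('n). e i x [w] *\<^sub>R frame_at x i c) # []) =
          (\<Sum>i=1..CARD('n). e i x [w] * e j x ([] @ frame_at x i # []))"
        by (intro alternating_linear_sum[OF alt[OF j] tangent_nonempty[OF x]]
            dual_frame_properties[OF x])
      also have "\<dots> = (\<Sum>i=1..CARD('n). if i = j then e j x [w] else 0)"
        by (rule sum.cong[OF refl]) (simp add: dual_frame_properties(2)[OF x _ j])
      finally show ?thesis using j by simp
    qed
  qed
  show ?thesis
  proof unfold_locales
    show "e i x vs = 0" if "i \<in> {1..CARD('n)}" "length vs \<noteq> 1" for i vs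
      using coframe_cotangent[OF x that(1)] that(2) by (simp add: cotangent_space_def)
  qed (use dual_frame_properties[OF x] alt span tangent_nonempty[OF x] in \<open>auto; fail\<close>)+
qed

end

section \<open>Smooth sections\<close>

context local_orthonormal_coframe
begin

abbreviation \<Omega> :: "('a, 'n) form set" where "\<Omega> \<equiv> forms A U"

abbreviation domain :: "('a, 'n) chart \<Rightarrow> (real ^ 'n) set" where
  "domain c \<equiv> snd c ` (fst c \<inter> U)"

lemma open_domain: "c \<in> A \<Longrightarrow> open (domain c)"
  by (rule open_chart_image[OF manifold _ open_U])

lemma domain_point:
  assumes "c \<in> A" "y \<in> domain c"
  shows "chart_inv c y \<in> fst c" "chart_inv c y \<in> U"
  using assms by (auto simp: chart_inv_eq[OF manifold])

lemma forms_alternating: "f \<in> \<Omega> \<Longrightarrow> x \<in> U \<Longrightarrow> f x \<in> alternating_forms (tangent_space A x)"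
  by (simp add: forms_def ext_cotangent_eq)

lemma forms_outside: "f \<in> \<Omega> \<Longrightarrow> x \<notin> U \<Longrightarrow> f x = (\<lambda>vs. 0)"
  by (auto simp: forms_def)

lemma forms_smooth:
  "f \<in> \<Omega> \<Longrightarrow> c \<in> A \<Longrightarrow>
   smooth_on (domain c) (\<lambda>y. f (chart_inv c y) (map (coord_vec A c (chart_inv c y)) is))"
  by (simp add: forms_def Let_def)

lemma formsI:
  assumes "\<And>x. x \<in> U \<Longrightarrow> f x \<in> alternating_forms (tangent_space A x)"
    and "\<And>x vs. x \<notin> U \<Longrightarrow> f x vs = 0"
    and "\<And>c is. c \<in> A \<Longrightarrow>
      smooth_on (domain c) (\<lambda>y. f (chart_inv c y) (map (coord_vec A c (chart_inv c y)) is))"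
  shows "f \<in> \<Omega>"
  using assms by (simp add: forms_def ext_cotangent_eq Let_def)

lemma smooth_fun_smooth:
  "smooth_fun A U k \<Longrightarrow> c \<in> A \<Longrightarrow> smooth_on (domain c) (\<lambda>y. k (chart_inv c y))"
  by (simp add: smooth_fun_def comp_def)

lemma smooth_fun_const: "smooth_fun A U (\<lambda>x. k)"
  by (simp add: smooth_fun_def comp_def smooth_on_const)

lemma smooth_fun_component: "f \<in> \<Omega> \<Longrightarrow> smooth_fun A U (\<lambda>x. f x [])"
  using forms_smooth[of f _ "[]"] by (simp add: smooth_fun_def comp_def)

lemma forms_zero: "(\<lambda>x vs. 0) \<in> \<Omega>"
  by (rule formsI) (auto simp: alternating_zero smooth_on_const)

lemma forms_add: "f \<in> \<Omega> \<Longrightarrow> h \<in> \<Omega> \<Longrightarrow> (\<lambda>x vs. f x vs + h x vs) \<in> \<Omega>"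
  by (rule formsI)
    (simp_all add: forms_outside alternating_add forms_alternating smooth_on_add forms_smooth
      open_domain)

lemma forms_mult: "smooth_fun A U k \<Longrightarrow> f \<in> \<Omega> \<Longrightarrow> (\<lambda>x vs. k x * f x vs) \<in> \<Omega>"
  by (rule formsI)
    (simp_all add: forms_outside alternating_scale forms_alternating smooth_on_mult forms_smooth
      open_domain smooth_fun_smooth)

lemma forms_scale: "f \<in> \<Omega> \<Longrightarrow> (\<lambda>x vs. k * f x vs) \<in> \<Omega>"
  by (rule forms_mult[OF smooth_fun_const])

lemma forms_sum: "(\<And>i. i \<in> I \<Longrightarrow> f i \<in> \<Omega>) \<Longrightarrow> (\<lambda>x vs. \<Sum>i\<in>I. f i x vs) \<in> \<Omega>"
  by (induction I rule: infinite_finite_induct) (auto simp: forms_zero intro: forms_add)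

lemma unit_form_eq: "x \<in> U \<Longrightarrow> unit_form U x = alt_unit"
  by (simp add: unit_form_def alt_unit_def fun_eq_iff)

lemma forms_unit: "unit_form U \<in> \<Omega>"
proof (rule formsI)
  show "unit_form U x \<in> alternating_forms (tangent_space A x)" if "x \<in> U" for x
    using that by (simp add: unit_form_eq alternating_unit)
  show "unit_form U x vs = 0" if "x \<notin> U" for x vs
    using that by (simp add: unit_form_def)
  show "smooth_on (domain c)
      (\<lambda>y. unit_form U (chart_inv c y) (map (coord_vec A c (chart_inv c y)) is))" if "c \<in> A" for c "is"
    by (rule smooth_on_cong[OF open_domain[OF that] _ smooth_on_const[of _ "if is = [] then 1 else 0"]])
      (use domain_point[OF that] in \<open>auto simp: unit_form_def\<close>)
qed

lemma forms_wedge: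
  assumes f: "f \<in> \<Omega>" and h: "h \<in> \<Omega>"
  shows "wedge f h \<in> \<Omega>"
proof (rule formsI)
  show "wedge f h x \<in> alternating_forms (tangent_space A x)" if "x \<in> U" for x
    unfolding wedge_eq_alt_wedge
    by (intro tangent_vectors.alternating_wedge tangent_vectors_at forms_alternating f h that)
  show "wedge f h x vs = 0" if "x \<notin> U" for x vs
    using forms_outside[OF f that] by (simp add: wedge_eq_alt_wedge)
  show "smooth_on (domain c)
      (\<lambda>y. wedge f h (chart_inv c y) (map (coord_vec A c (chart_inv c y)) is))" if "c \<in> A" for c "is"
    unfolding wedge_def nths_map length_map
    by (intro smooth_on_sum smooth_on_mult smooth_on_const forms_smooth f h that open_domain)
qed

lemma coframe_forms: "i \<in> {1..CARD('n)} \<Longrightarrow> e i \<in> \<Omega>"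
  using orthonormal unfolding orthonormal_coframe_def coframe_def by blast

lemma forms_monomial:
  "set is \<subseteq> {1..CARD('n)} \<Longrightarrow> foldr (\<lambda>i. wedge (e i)) is (unit_form U) \<in> \<Omega>"
proof (induction "is")
  case Nil
  show ?case by (simp add: forms_unit)
next
  case (Cons i "is")
  then show ?case using forms_wedge[OF coframe_forms, of i] by simp
qed

lemma forms_volume: "volume_form U e \<in> \<Omega>"
  unfolding volume_form_def by (rule forms_monomial) (auto simp del: upt_Suc)

lemma alternating_coords:
  assumes "c \<in> A" "x \<in> fst c" "x \<in> U" "\<alpha> \<in> alternating_forms (tangent_space A x)"
    "v \<in> tangent_space A x"
  shows "\<alpha> (v # vs) = (\<Sum>k\<in>UNIV. (v c $ k) * \<alpha> (coord_vec A c x k # vs))"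
proof -
  interpret tangent_vectors "tangent_space A x" by (rule tangent_vectors_at)
  have "\<alpha> ([] @ (\<lambda>d. \<Sum>k\<in>UNIV. (v c $ k) *\<^sub>R coord_vec A c x k d) # vs) =
      (\<Sum>k\<in>UNIV. (v c $ k) * \<alpha> ([] @ coord_vec A c x k # vs))"
    by (rule alternating_linear_sum[OF assms(4) tangent_nonempty[OF assms(3)]])
      (rule coord_vec_tangent[OF manifold assms(1,2)])
  then show ?thesis using tangent_vector_coords[OF manifold assms(1,2,5)] by simp
qed

text \<open>The coordinates of the dual frame solve a linear system whose matrix \<open>m\<close> consists of the
  components \<open>e\<^sup>a(\<partial>\<^sub>b)\<close>, which are smooth. The system is regular since the dual frame itself provides
  an inverse matrix, and Cramer's rule writes the solution as a quotient of determinants.\<close>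

lemma frame_coords_smooth:
  assumes c: "c \<in> A" and j: "j \<in> {1..CARD('n)}"
  shows "smooth_on (domain c) (\<lambda>y. dual_frame A e j (chart_inv c y) c $ k)"
proof -
  \<comment> \<open>Coframes are indexed by numbers, matrices by the type \<open>'n\<close>.\<close>
  obtain \<beta> where \<beta>: "bij_betw \<beta> (UNIV :: 'n set) {1..CARD('n)}"
    using finite_same_card_bij[of "UNIV :: 'n set" "{1..CARD('n)}"] by auto
  have \<beta>_in: "\<beta> a \<in> {1..CARD('n)}" for a using \<beta> by (auto simp: bij_betw_def)
  obtain j' where j': "\<beta> j' = j" using \<beta> j by (metis bij_betw_imp_surj_on imageE)
  have \<beta>_eq: "\<beta> a = \<beta> b \<longleftrightarrow> a = b" for a b using \<beta> by (auto simp: bij_betw_def inj_def)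
  define m where "m y = (\<chi> a b. e (\<beta> a) (chart_inv c y) [coord_vec A c (chart_inv c y) b])" for y
  define u where "u = (axis j' 1 :: real ^ 'n)"
  have coords: "(\<Sum>b\<in>UNIV. m y $ a $ b * dual_frame A e (\<beta> i) (chart_inv c y) c $ b) =
      (if a = i then 1 else 0)" if y: "y \<in> domain c" for y a i
  proof -
    note x = domain_point[OF c y]
    have "e (\<beta> a) (chart_inv c y) [dual_frame A e (\<beta> i) (chart_inv c y)] = (if a = i then 1 else 0)"
      using dual_frame_properties(2)[OF x(2) \<beta>_in \<beta>_in] by (simp add: \<beta>_eq)
    then show ?thesis
      using alternating_coords[OF c x forms_alternating[OF coframe_forms[OF \<beta>_in] x(2)]
          dual_frame_properties(1)[OF x(2) \<beta>_in], of a i "[]"]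
      by (simp add: m_def mult.commute)
  qed
  have det: "det (m y) \<noteq> 0" if y: "y \<in> domain c" for y
  proof -
    have "m y ** (\<chi> b i. dual_frame A e (\<beta> i) (chart_inv c y) c $ b) = mat 1"
      using coords[OF y] by (simp add: matrix_matrix_mult_def mat_def vec_eq_iff)
    then show ?thesis using invertible_det_nz invertible_right_inverse by blast
  qed
  have entries: "smooth_on (domain c) (\<lambda>y. m y $ a $ b)" for a b
    using forms_smooth[OF coframe_forms[OF \<beta>_in] c, of a "[b]"] by (simp add: m_def)
  have smooth: "smooth_on (domain c) (\<lambda>y. det (\<chi> a b. if b = k then u $ a else m y $ a $ b) / det (m y))"
  proof (intro smooth_on_divide smooth_on_det open_domain[OF c] det entries)
    show "smooth_on (domain c) (\<lambda>y. (\<chi> a b. if b = k then u $ a else m y $ a $ b) $ a $ b)" for a b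
      by (cases "b = k") (auto simp: smooth_on_const entries)
  qed
  have solution: "det (\<chi> a b. if b = k then u $ a else m y $ a $ b) / det (m y) =
      dual_frame A e j (chart_inv c y) c $ k" if y: "y \<in> domain c" for y
  proof -
    have "m y *v (dual_frame A e j (chart_inv c y) c) = u"
      using coords[OF y, of _ j'] by (auto simp: matrix_vector_mult_def vec_eq_iff u_def axis_def j')
    then have "dual_frame A e j (chart_inv c y) c =
        (\<chi> k. det (\<chi> a b. if b = k then u $ a else m y $ a $ b) / det (m y))"
      by (simp only: cramer[OF det[OF y]])
    then show ?thesis by (simp only: vec_lambda_beta)
  qed
  show ?thesis by (rule smooth_on_cong[OF open_domain[OF c] solution smooth])
qed

lemma forms_contract:
  assumes j: "j \<in> {1..CARD('n)}" and f: "f \<in> \<Omega>"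
  shows "contract (dual_frame A e j) f \<in> \<Omega>"
proof (rule formsI)
  show "contract (dual_frame A e j) f x \<in> alternating_forms (tangent_space A x)" if "x \<in> U" for x
    unfolding contract_eq_contraction by (intro alternating_contraction forms_alternating f that)
  show "contract (dual_frame A e j) f x vs = 0" if "x \<notin> U" for x vs
    by (simp add: contract_def forms_outside[OF f that])
  fix c "is" assume c: "c \<in> A"
  let ?x = "chart_inv c"
  show "smooth_on (domain c)
      (\<lambda>y. contract (dual_frame A e j) f (?x y) (map (coord_vec A c (?x y)) is))"
  proof (rule smooth_on_cong[OF open_domain[OF c]])
    show "smooth_on (domain c) (\<lambda>y. \<Sum>k\<in>UNIV. dual_frame A e j (?x y) c $ k *
        f (?x y) (map (coord_vec A c (?x y)) (k # is)))"
      by (intro smooth_on_sum smooth_on_mult frame_coords_smooth forms_smooth open_domain c j f)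
    show "(\<Sum>k\<in>UNIV. dual_frame A e j (?x y) c $ k * f (?x y) (map (coord_vec A c (?x y)) (k # is))) =
        contract (dual_frame A e j) f (?x y) (map (coord_vec A c (?x y)) is)" if "y \<in> domain c" for y
      using alternating_coords[OF c domain_point[OF c that] forms_alternating[OF f]
          dual_frame_properties(1)[OF _ j]] domain_point[OF c that]
      by (simp add: contract_def)
  qed
qed

definition hodge_form :: "('a, 'n) form \<Rightarrow> ('a, 'n) form" where
  "hodge_form f = (\<lambda>x. alt_hodge CARD('n) sign (frame_at x) (volume_form U e x) (f x))"

lemma forms_pairing:
  "f \<in> \<Omega> \<Longrightarrow> h \<in> \<Omega> \<Longrightarrow> (\<lambda>x. pairing CARD('n) sign (frame_at x) r (f x) (h x)) \<in> \<Omega>"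
proof (induction r arbitrary: f h)
  case 0
  then show ?case by (simp add: forms_mult smooth_fun_component)
next
  case (Suc r)
  have "(\<lambda>x vs. \<Sum>i=1..CARD('n). sign i * pairing CARD('n) sign (frame_at x) r
      (contract (dual_frame A e i) f x) (contract (dual_frame A e i) h x) vs) \<in> \<Omega>"
    by (intro forms_sum forms_scale Suc.IH forms_contract Suc.prems)
  then show ?case by (simp add: contract_eq_contraction)
qed

lemma forms_hodge: "f \<in> \<Omega> \<Longrightarrow> hodge_form f \<in> \<Omega>"
  unfolding hodge_form_def alt_hodge_def
  by (intro forms_sum forms_scale forms_pairing forms_volume)

lemma volume_form_at:
  assumes x: "x \<in> U"
  shows "volume_form U e x = weighted_frame.volume CARD('n) (\<lambda>i. e i x)"
proof -
  interpret weighted_frame "tangent_space A x" "CARD('n)" sign "frame_at x" "\<lambda>i. e i x"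
    by (rule weighted_frame_at[OF x])
  have "foldr (\<lambda>i. wedge (e i)) is (unit_form U) x = monomial is" for "is"
    by (induction "is") (simp_all add: unit_form_eq[OF x] wedge_eq_alt_wedge ext_def)
  then show ?thesis unfolding volume_form_def volume_def .
qed

section \<open>The Graf product\<close>

text \<open>In an orthonormal coframe the double sum over indices collapses to the diagonal.\<close>

lemma contracted_wedge_at:
  assumes x: "x \<in> U"
  shows "contracted_wedge A g e l f h x =
    alt_contracted_wedge CARD('n) sign (frame_at x) l (f x) (h x)"
proof (induction l arbitrary: f h)
  case 0
  then show ?case by (simp add: wedge_eq_alt_wedge)
next
  case (Suc l)
  have metric: "dual_metric A g x (e i x) (e j x) = (if i = j then sign i else 0)"
    if "i \<in> {1..CARD('n)}" "j \<in> {1..CARD('n)}" for i j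
  proof -
    have "dual_metric A g x (e i x) (e j x) = sign_matrix p i j"
      using orthonormal x that unfolding orthonormal_coframe_def by blast
    then show ?thesis by (simp add: sign_matrix_def)
  qed
  show ?case
  proof
    fix vs
    let ?F = "\<lambda>i j. alt_contracted_wedge CARD('n) sign (frame_at x) l
        (contraction (frame_at x i) (f x)) (contraction (frame_at x j) (h x)) vs"
    have "contracted_wedge A g e (Suc l) f h x vs =
        (\<Sum>i=1..CARD('n). \<Sum>j=1..CARD('n). dual_metric A g x (e i x) (e j x) * ?F i j)"
      by (simp add: Suc.IH contract_eq_contraction)
    also have "\<dots> = (\<Sum>i=1..CARD('n). \<Sum>j=1..CARD('n). if i = j then sign i * ?F i i else 0)"
      by (intro sum.cong refl) (simp add: metric)
    also have "\<dots> = (\<Sum>i=1..CARD('n). sign i * ?F i i)"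
      by (intro sum.cong refl) simp
    finally show "contracted_wedge A g e (Suc l) f h x vs =
        alt_contracted_wedge CARD('n) sign (frame_at x) (Suc l) (f x) (h x) vs"
      by simp
  qed
qed

lemma contracted_wedge_zero:
  assumes "(\<forall>vs. f x vs = 0) \<or> (\<forall>vs. h x vs = 0)"
  shows "contracted_wedge A g e l f h x vs = 0"
  using assms
proof (induction l arbitrary: f h vs)
  case 0
  then show ?case by (auto simp: wedge_def)
next
  case (Suc l)
  have "contracted_wedge A g e l (contract X f) (contract Y h) x vs = 0" for X Y
    by (rule Suc.IH) (use Suc.prems in \<open>auto simp: contract_def\<close>)
  then show ?case by simp
qed

lemma graf_homogeneous_zero:
  assumes "(\<forall>vs. f x vs = 0) \<or> (\<forall>vs. h x vs = 0)"
  shows "graf_homogeneous A g e r s f h x vs = 0"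
proof -
  have "contracted_wedge A g e l f h x vs = 0" "contracted_wedge A g e l h f x vs = 0" for l
    using assms by (blast intro: contracted_wedge_zero)+
  then show ?thesis by (simp add: graf_homogeneous_def)
qed

text \<open>As a section, \<open>(1 + \<eta> \<nu>) / 2\<close> has components in degrees 0 and \<open>n\<close> only. The first one reproduces
  \<open>f\<close>, and the second one gives the Hodge operator. The two are different degrees because
  \<open>n \<ge> 1\<close>.\<close>

lemma P_map_at:
  assumes f: "f \<in> \<Omega>" and x: "x \<in> U"
  shows "P_map A g U e \<eta> f x vs = (1 / 2) * (f x vs + \<eta> * hodge_form f x vs)"
proof -
  interpret weighted_frame "tangent_space A x" "CARD('n)" sign "frame_at x" "\<lambda>i. e i x"
    by (rule weighted_frame_at[OF x])
  note volume_at = volume_form_at[OF x]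
  have fx: "f x \<in> alternating_forms (tangent_space A x)" by (rule forms_alternating[OF f x])
  let ?n = "CARD('n)"
  let ?p = "\<lambda>s. deg_part s (p_elem U e \<eta>)"
  have p0: "?p 0 x = (\<lambda>vs. (1 / 2) * alt_unit vs)"
    by (auto simp: deg_part_def p_elem_def volume_at volume_degree unit_form_eq[OF x]
        alt_unit_def fun_eq_iff)
  have pn: "?p ?n x = (\<lambda>vs. (\<eta> / 2) * volume vs)"
    by (auto simp: deg_part_def p_elem_def volume_at volume_degree unit_form_eq[OF x]
        alt_unit_def fun_eq_iff)
  have pz: "?p s x vs = 0" if "s \<noteq> 0" "s \<noteq> ?n" for s vs
    using that by (auto simp: deg_part_def p_elem_def volume_at volume_degree unit_form_eq[OF x]
        alt_unit_def)
  have part: "deg_part r f x \<in> alternating_forms (tangent_space A x)" for r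
  proof -
    have "deg_part r f x = (\<lambda>vs. (if length vs = r then 1 else 0) * f x vs)"
      by (auto simp: deg_part_def)
    then show ?thesis
      using alternating_graded_scale[OF fx, of "\<lambda>m. if m = r then 1 else 0"] by simp
  qed
  have unit: "graf_homogeneous A g e r 0 (deg_part r f) (?p 0) x vs = (1 / 2) * deg_part r f x vs" for r
  proof -
    have "alt_wedge (?p 0 x) (deg_part r f x) vs = (1 / 2) * deg_part r f x vs"
      "alt_wedge (deg_part r f x) (?p 0 x) vs = (1 / 2) * deg_part r f x vs"
      by (simp_all only: p0 alt_wedge_scale_left alt_wedge_scale_right
          alt_wedge_unit_left alt_wedge_unit_right)
    then show ?thesis
      by (cases "r = 0") (simp_all add: graf_homogeneous_def wedge_eq_alt_wedge)
  qed
  have vol: "graf_homogeneous A g e r ?n (deg_part r f) (?p ?n) x vs =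
      (\<eta> / 2) * (hodge_coeff r * pair r (f x) volume vs)" if "r \<le> ?n" for r
  proof -
    have "graf_homogeneous A g e r ?n (deg_part r f) (?p ?n) x vs =
        (\<eta> / 2) * (\<Sum>l=0..r. (-1) ^ (l * (r - l) + l div 2) / fact l *
            alt_contracted_wedge ?n sign (frame_at x) l (deg_part r f x) volume vs)"
      unfolding graf_homogeneous_def contracted_wedge_at[OF x] pn alt_contracted_wedge_scale_right
        sum_distrib_left using that by (simp add: mult_ac)
    also have "\<dots> = (\<eta> / 2) * (hodge_coeff r * pair r (deg_part r f x) volume vs)"
      by (subst graf_sum_volume[OF part]) (auto simp: deg_part_def)
    also have "pair r (deg_part r f x) volume vs = pair r (f x) volume vs"
      by (rule pairing_cong_left) (simp add: deg_part_def)
    finally show ?thesis .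
  qed
  have "P_map A g U e \<eta> f x vs = (\<Sum>r=0..?n. \<Sum>s=0..?n.
      graf_homogeneous A g e r s (deg_part r f) (?p s) x vs)"
    by (simp add: P_map_def graf_def)
  also have "\<dots> = (\<Sum>r=0..?n. \<Sum>s\<in>{0, ?n}.
      graf_homogeneous A g e r s (deg_part r f) (?p s) x vs)"
    by (intro sum.cong refl sum.mono_neutral_right) (auto intro!: graf_homogeneous_zero simp: pz)
  also have "\<dots> = (\<Sum>r=0..?n. (1 / 2) * deg_part r f x vs +
      (\<eta> / 2) * (hodge_coeff r * pair r (f x) volume vs))"
    by (intro sum.cong refl) (simp add: unit vol)
  also have "\<dots> = (1 / 2) * (\<Sum>r=0..?n. deg_part r f x vs) + (\<eta> / 2) * hodge (f x) vs"
    by (simp add: sum.distrib sum_distrib_left alt_hodge_def atLeast0AtMost)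
  also have "(\<Sum>r=0..?n. deg_part r f x vs) = f x vs"
    using alternating_vanishes[OF fx, of vs] by (auto simp: deg_part_def)
  finally show ?thesis by (simp add: hodge_form_def volume_at algebra_simps)
qed

lemma P_map_eq:
  assumes f: "f \<in> \<Omega>"
  shows "P_map A g U e \<eta> f = (\<lambda>x vs. (1 / 2) * (f x vs + \<eta> * hodge_form f x vs))"
proof (intro ext)
  fix x vs
  show "P_map A g U e \<eta> f x vs = (1 / 2) * (f x vs + \<eta> * hodge_form f x vs)"
  proof (cases "x \<in> U")
    case True
    then show ?thesis by (rule P_map_at[OF f])
  next
    case False
    then show ?thesis
      using forms_outside[OF f] forms_outside[OF forms_hodge[OF f]]
      by (simp add: P_map_def graf_def graf_homogeneous_zero deg_part_def)
  qed
qed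

lemma hodge_form_add:
  "hodge_form (\<lambda>x vs. f x vs + h x vs) = (\<lambda>x vs. hodge_form f x vs + hodge_form h x vs)"
  by (simp add: hodge_form_def alt_hodge_def pairing_add_left sum.distrib algebra_simps)

lemma hodge_form_mult: "hodge_form (\<lambda>x vs. k x * f x vs) = (\<lambda>x vs. k x * hodge_form f x vs)"
  by (simp add: hodge_form_def alt_hodge_def pairing_scale_left sum_distrib_left mult_ac)

lemma hodge_form_involution:
  assumes "(\<Prod>i=1..CARD('n). sign i) * (-1) ^ (CARD('n) div 2) = 1" and f: "f \<in> \<Omega>"
  shows "hodge_form (hodge_form f) = f"
proof (intro ext)
  fix x vs
  show "hodge_form (hodge_form f) x vs = f x vs"
  proof (cases "x \<in> U")
    case True
    interpret weighted_frame "tangent_space A x" "CARD('n)" sign "frame_at x" "\<lambda>i. e i x"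
      by (rule weighted_frame_at[OF True])
    show ?thesis
      using hodge_involution[OF assms(1) forms_alternating[OF f True]]
      by (simp add: hodge_form_def volume_form_at[OF True])
  next
    case False
    then show ?thesis using forms_outside f forms_hodge by simp
  qed
qed

lemma P_map_image_submodule: "submodule_of_forms A U (P_map A g U e \<eta> ` \<Omega>)"
proof -
  have into: "P_map A g U e \<eta> f \<in> \<Omega>" if "f \<in> \<Omega>" for f
    unfolding P_map_eq[OF that] by (intro forms_scale forms_add forms_hodge that)
  have mult: "(\<lambda>x vs. k x * P_map A g U e \<eta> f x vs) = P_map A g U e \<eta> (\<lambda>x vs. k x * f x vs)"
    if "f \<in> \<Omega>" "smooth_fun A U k" for f k
    by (simp add: P_map_eq forms_mult that hodge_form_mult algebra_simps)
  have add: "(\<lambda>x vs. P_map A g U e \<eta> f x vs + P_map A g U e \<eta> h x vs) =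
      P_map A g U e \<eta> (\<lambda>x vs. f x vs + h x vs)" if "f \<in> \<Omega>" "h \<in> \<Omega>" for f h
    by (simp add: P_map_eq forms_add that hodge_form_add algebra_simps)
  have zero: "(\<lambda>x vs. 0) = P_map A g U e \<eta> (\<lambda>x vs. 0)"
    using mult[OF forms_zero smooth_fun_const[of 0]] by simp
  show ?thesis
    unfolding submodule_of_forms_def
  proof (intro conjI ballI allI impI)
    show "P_map A g U e \<eta> ` \<Omega> \<subseteq> \<Omega>" using into by blast
    show "(\<lambda>x vs. 0) \<in> P_map A g U e \<eta> ` \<Omega>" using zero forms_zero by blast
    show "(\<lambda>x vs. f x vs + h x vs) \<in> P_map A g U e \<eta> ` \<Omega>"
      if "f \<in> P_map A g U e \<eta> ` \<Omega>" "h \<in> P_map A g U e \<eta> ` \<Omega>" for f h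
      using that add forms_add by (auto intro!: image_eqI)
    show "(\<lambda>x vs. k x * f x vs) \<in> P_map A g U e \<eta> ` \<Omega>"
      if "smooth_fun A U k" "f \<in> P_map A g U e \<eta> ` \<Omega>" for k f
      using that mult forms_mult by (auto intro!: image_eqI)
  qed
qed

text \<open>The images of \<open>P\<^sub>+\<close> and \<open>P\<^sub>-\<close> consist of eigenvectors of the involution \<open>\<star>\<close> for the eigenvalues
  \<open>1\<close> and \<open>-1\<close>, so their intersection is zero.\<close>

lemma forms_direct_sum_if_volume_square:
  assumes sign: "(\<Prod>i=1..CARD('n). sign i) * (-1) ^ (CARD('n) div 2) = 1"
  shows "forms_direct_sum A U (Gamma_plus A g U e) (Gamma_minus A g U e)"
proof -
  let ?V = "P_map A g U e 1 ` \<Omega>" and ?W = "P_map A g U e (-1) ` \<Omega>"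
  have eigen: "hodge_form (P_map A g U e \<eta> f) = (\<lambda>x vs. \<eta> * P_map A g U e \<eta> f x vs)"
    if "f \<in> \<Omega>" "\<eta> * \<eta> = 1" for \<eta> f
  proof -
    have "hodge_form (P_map A g U e \<eta> f) = (\<lambda>x vs. (1 / 2) * (hodge_form f x vs + \<eta> * f x vs))"
      by (simp only: P_map_eq[OF that(1)] hodge_form_mult[of "\<lambda>_. 1 / 2"] hodge_form_add
          hodge_form_mult[of "\<lambda>_. \<eta>"] hodge_form_involution[OF sign that(1)])
    also have "\<dots> = (\<lambda>x vs. (1 / 2) * (\<eta> * \<eta> * hodge_form f x vs + \<eta> * f x vs))"
      by (simp add: that(2))
    finally show ?thesis by (simp add: P_map_eq[OF that(1)] algebra_simps)
  qed
  have split: "f = (\<lambda>x vs. P_map A g U e 1 f x vs + P_map A g U e (-1) f x vs)" if "f \<in> \<Omega>" for f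
    by (simp add: P_map_eq that field_simps)
  have "\<Omega> = {(\<lambda>x vs. f x vs + h x vs) | f h. f \<in> ?V \<and> h \<in> ?W}"
  proof (intro equalityI subsetI)
    show "f \<in> {(\<lambda>x vs. f x vs + h x vs) | f h. f \<in> ?V \<and> h \<in> ?W}" if "f \<in> \<Omega>" for f
      by (rule CollectI, intro exI conjI) (rule split[OF that], (rule imageI[OF that])+)
    show "k \<in> \<Omega>" if k: "k \<in> {(\<lambda>x vs. f x vs + h x vs) | f h. f \<in> ?V \<and> h \<in> ?W}" for k
    proof -
      obtain f h where sum: "k = (\<lambda>x vs. f x vs + h x vs)" and "f \<in> ?V" "h \<in> ?W"
        using k by blast
      moreover have "?V \<subseteq> \<Omega>" "?W \<subseteq> \<Omega>"
        using P_map_image_submodule unfolding submodule_of_forms_def by blast+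
      ultimately show ?thesis unfolding sum by (intro forms_add) blast+
    qed
  qed
  moreover have "?V \<inter> ?W = {\<lambda>x vs. 0}"
  proof (intro equalityI subsetI)
    fix k assume "k \<in> ?V \<inter> ?W"
    then have "hodge_form k = (\<lambda>x vs. 1 * k x vs)" "hodge_form k = (\<lambda>x vs. (-1) * k x vs)"
      using eigen[of _ 1] eigen[of _ "-1"] by auto
    then have "k x vs = - k x vs" for x vs by (metis mult_1 mult_minus1)
    then show "k \<in> {\<lambda>x vs. 0}" by (auto simp: fun_eq_iff)
  next
    show "k \<in> ?V \<inter> ?W" if "k \<in> {\<lambda>x vs. 0}" for k
    proof -
      have "(\<lambda>x vs. 0) \<in> P_map A g U e \<eta> ` \<Omega>" for \<eta>
        using P_map_image_submodule unfolding submodule_of_forms_def by blast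
      then show ?thesis using that by simp
    qed
  qed
  ultimately show ?thesis
    unfolding forms_direct_sum_def Gamma_plus_def Gamma_minus_def
    using P_map_image_submodule by blast
qed

end

section \<open>The signature condition\<close>

lemma prod_sign_matrix: "(\<Prod>i=1..p+q. sign_matrix p i i) = (-1) ^ q"
proof (induction q)
  case 0
  then show ?case by (simp add: sign_matrix_def)
next
  case (Suc q)
  then show ?case by (simp add: sign_matrix_def)
qed

text \<open>Modulo 2, with \<open>m = p - q\<close> and \<open>n = m + 2 q\<close>, the exponent \<open>q + n (n - 1) / 2\<close> is
  \<open>m (m - 1) / 2\<close>, which is even for \<open>m\<close> congruent to 0 or 1 modulo 4.\<close>

lemma volume_square_sign:
  assumes "(int p - int q) mod 8 \<in> {0, 1, 4, 5}"
  shows "(\<Prod>i=1..p+q. sign_matrix p i i) * (-1) ^ ((p + q) div 2) = 1"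
proof -
  have "even (q + (p + q) div 2)" using assms by auto presburger+
  then show ?thesis unfolding prod_sign_matrix power_add[symmetric] by simp
qed

theorem proposition3p12:
  fixes M :: "'a topology"
    and A :: "('a, 'n::finite) chart set"
    and g :: "('a, 'n) metric"
    and p q :: nat
    and U :: "'a set"
    and e :: "nat \<Rightarrow> ('a, 'n) form"
  assumes "smooth_manifold M A"
    and "paracompact_space M"
    and "connected_space M"
    and "pseudo_riemannian_metric M A g p q"
    and "openin M U"
    and "orthonormal_coframe A g p U e"
    and "(int p - int q) mod 8 \<in> {0, 1, 4, 5}"
  shows "forms_direct_sum A U (Gamma_plus A g U e) (Gamma_minus A g U e)"
proof -
  interpret local_orthonormal_coframe M A g p q U e
    using assms by unfold_locales
  have "CARD('n) = p + q" using assms(4) by (simp add: pseudo_riemannian_metric_def)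
  then show ?thesis using volume_square_sign[OF assms(7)] by (intro forms_direct_sum_if_volume_square) simp
qed

end
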